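(* For each integer $r \geq 2$, there exists a constant $C = C(r) > 0$ such that the following holds. Let $n, k$ be positive integers with $n \geq 2k + C k^{2/3}$, and let $\mathcal{F} \subset \binom{[n]}{k}$ be a union of at most $r$ intersecting families (i.e.\ $\mathcal{F} = \mathcal{F}_1 \cup \cdots \cup \mathcal{F}_m$ with $m \leq r$, where each $\mathcal{F}_i \subset \binom{[n]}{k}$ is intersecting). Then $$|\mathcal{F}| \leq \binom{n}{k} - \binom{n-r}{k},$$ and equality holds only if $\mathcal{F} = \{S \in \binom{[n]}{k} : S \cap R \neq \emptyset\}$ for some $R \in \binom{[n]}{r}$.
   Context: $[n] = \{1,\ldots,n\}$ and $\binom{[n]}{k}$ is the set of $k$-element subsets of $[n]$. A family of sets is intersecting if any two of its members have nonempty intersection. *)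

theory Defs
  imports Complex_Main "HOL-Library.Ramsey"
begin

definition intersecting :: "'a set set \<Rightarrow> bool" where
  "intersecting F \<longleftrightarrow> (\<forall>A\<in>F. \<forall>B\<in>F. A \<inter> B \<noteq> {})"

definition union_of_intersecting :: "nat \<Rightarrow> nat \<Rightarrow> nat \<Rightarrow> nat set set \<Rightarrow> bool" where
  "union_of_intersecting r n k F \<longleftrightarrow>
     (\<exists>m G. m \<le> r \<and>
        (\<forall>i\<in>{1..m}. G i \<subseteq> [{1..n}]\<^bsup>k\<^esup> \<and> intersecting (G i)) \<and>
        F = (\<Union>i\<in>{1..m::nat}. G i))"

end

theory Submission
  imports Defs "HOL-Probability.Probability"
begin

text \<open>
  Suppose \<open>|F|\<close> is at least the claimed maximum. The sets containing no member of \<open>F\<close> form a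
  down-closed family \<open>D\<close> with at most \<open>(n - r choose k)\<close> sets of size \<open>k\<close>, so by
  Kruskal-Katona its \<open>p\<close>-biased measure is at most \<open>(1 - p)^r\<close> plus a binomial tail, for
  \<open>p\<close> halfway between \<open>k/n\<close> and \<open>1/2\<close>. On the other hand \<open>D\<close> is the intersection of the
  complements of the up-closures of the \<open>F_i\<close>, each of measure at least \<open>1 - p\<close>, so Harris'
  inequality forces every up-closure to have measure \<open>p\<close> up to an exponentially small error.

  For an increasing intersecting family, with \<open>p = 2^(-c)\<close>, the inequality
  \<open>\<mu>_p(A) \<le> \<mu>_(1/2)(A)^c\<close> applied to the two sections in a direction \<open>x\<close> shows that the
  lower section has \<open>1/2\<close>-measure near \<open>0\<close> or near \<open>1/2\<close>. By Poincare's inequality it cannot be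
  near \<open>1/2\<close> in all directions, so each \<open>F_i\<close> is, up to few exceptional sets, a star with some
  centre \<open>x_i\<close>.

  Finally, the exceptional sets of \<open>F_i\<close> exclude all sets of the star of \<open>x_i\<close> that are disjoint
  from one of them. Since there are so few exceptional sets, Kruskal-Katona makes the number of sets
  lost exceed their number by a factor larger than \<open>r\<close>, so there are none.
  This is where \<open>n - 2k\<close> of order \<open>k^(2/3)\<close> is needed: gaining a constant factor requires the
  exceptional sets to have density below \<open>(k/2n)^s\<close> with \<open>s\<close> of order \<open>n/(n - 2k)\<close>, which the
  error \<open>exp(-(n - 2k)^2/8n)\<close> affords.
\<close>

section \<open>Cliques and shadows\<close>

definition facets_in :: "'a set set \<Rightarrow> 'a set set \<Rightarrow> bool" where
  "facets_in B A \<longleftrightarrow> (\<forall>T\<in>B. \<forall>x\<in>T. T - {x} \<in> A)"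

definition link :: "'a \<Rightarrow> 'a set set \<Rightarrow> 'a set set" where
  "link v A = {S. v \<notin> S \<and> insert v S \<in> A}"

definition avoiding :: "'a \<Rightarrow> 'a set set \<Rightarrow> 'a set set" where
  "avoiding v A = {S \<in> A. v \<notin> S}"

lemma finite_uniform: "finite V \<Longrightarrow> A \<subseteq> [V]\<^bsup>k\<^esup> \<Longrightarrow> finite A"
  by (meson finite_imp_finite_nsets finite_subset)

lemma card_link: "card (link v A) = card {S \<in> A. v \<in> S}"
proof (rule bij_betw_same_card[of "insert v"], rule bij_betw_byWitness[where f' = "\<lambda>S. S - {v}"])
  show "insert v ` link v A \<subseteq> {S \<in> A. v \<in> S}" "(\<lambda>S. S - {v}) ` {S \<in> A. v \<in> S} \<subseteq> link v A"
    by (auto simp: link_def insert_absorb)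
qed (auto simp: link_def)

lemma card_link_add_avoiding:
  assumes "finite A"
  shows "card (link v A) + card (avoiding v A) = card A"
proof -
  have "card A = card ({S \<in> A. v \<in> S} \<union> avoiding v A)"
    by (rule arg_cong[of _ _ card]) (auto simp: avoiding_def)
  also have "\<dots> = card {S \<in> A. v \<in> S} + card (avoiding v A)"
    using assms by (intro card_Un_disjoint) (auto simp: avoiding_def)
  finally show ?thesis by (simp add: card_link)
qed

lemma sum_card_link:
  assumes "finite V" "A \<subseteq> [V]\<^bsup>k\<^esup>"
  shows "(\<Sum>v\<in>V. card (link v A)) = k * card A"
  unfolding card_link
proof (rule sum_multicount)
  have "{v \<in> V. v \<in> S} = S" if "S \<in> A" for S
    using that assms(2) by (auto simp: nsets_def)
  then show "\<forall>S\<in>A. card {v \<in> V. v \<in> S} = k"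
    using assms(2) by (auto simp: nsets_def)
qed (use assms finite_uniform in auto)

lemma link_uniform: "A \<subseteq> [V]\<^bsup>Suc k\<^esup> \<Longrightarrow> link v A \<subseteq> [V]\<^bsup>k\<^esup>"
  by (auto simp: link_def nsets_def card_insert_if)

lemma facets_in_link:
  assumes "facets_in B A"
  shows "facets_in (link v B) (link v A)"
  unfolding facets_in_def
proof (intro ballI)
  fix T x assume "T \<in> link v B" "x \<in> T"
  then have "insert v T - {x} \<in> A" "v \<notin> T" "v \<noteq> x"
    using assms by (auto simp: facets_in_def link_def)
  then show "T - {x} \<in> link v A"
    by (simp add: link_def insert_Diff_if)
qed

lemma link_subset_avoiding: "facets_in B A \<Longrightarrow> link v B \<subseteq> avoiding v A"
  by (force simp: facets_in_def link_def avoiding_def)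

lemma Suc_times_choose_Suc: "Suc j * (N choose Suc j) = (N - j) * (N choose j)"
  by (metis binomial_absorption binomial_absorb_comp)

lemma card_pairs_le:
  assumes "finite V" "A \<subseteq> [V]\<^bsup>1\<^esup>" "B \<subseteq> [V]\<^bsup>2\<^esup>" "facets_in B A" "card A \<le> N"
  shows "2 * card B \<le> (N - 1) * card A"
proof -
  define U where "U = {x \<in> V. {x} \<in> A}"
  have U: "finite U" using assms(1) by (simp add: U_def)
  have "card U \<le> card A"
    using finite_uniform[OF assms(1,2)] by (intro card_inj_on_le[of "\<lambda>x. {x}"]) (auto simp: U_def)
  have "B \<subseteq> [U]\<^bsup>2\<^esup>"
  proof
    fix T assume T: "T \<in> B"
    then obtain x y where xy: "T = {x, y}" "x \<in> V" "y \<in> V" "x \<noteq> y"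
      using assms(3) by (blast elim: nsets2_E)
    have "T - {x} \<in> A" "T - {y} \<in> A"
      using assms(4) T xy(1) unfolding facets_in_def by blast+
    moreover have "T - {x} = {y}" "T - {y} = {x}" using xy(1,4) by auto
    ultimately show "T \<in> [U]\<^bsup>2\<^esup>"
      using xy by (simp add: U_def)
  qed
  then have "card B \<le> card U choose 2"
    using U by (metis card_mono card_nsets finite_imp_finite_nsets)
  then have "2 * card B \<le> card U * (card U - 1)" by (simp add: choose_two)
  also have "\<dots> \<le> card A * (N - 1)"
    using \<open>card U \<le> card A\<close> assms(5) by (intro mult_le_mono) auto
  finally show ?thesis by (simp add: mult.commute)
qed

lemma card_link_le_of_high_degree:
  assumes "finite A" "facets_in B A" "card A \<le> Suc M choose Suc k" "M choose k < card (link v A)"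
  shows "Suc k * card (link v B) \<le> (M - k) * card (link v A)"
proof -
  have "card (link v B) \<le> card (avoiding v A)"
    using assms(1) link_subset_avoiding[OF assms(2)] by (intro card_mono) (auto simp: avoiding_def)
  then have "card (link v B) \<le> M choose Suc k"
    using assms(3,4) card_link_add_avoiding[OF assms(1), of v] by simp
  then have "Suc k * card (link v B) \<le> Suc k * (M choose Suc k)" by (rule mult_le_mono2)
  also have "\<dots> = (M - k) * (M choose k)" by (rule Suc_times_choose_Suc)
  also have "\<dots> \<le> (M - k) * card (link v A)" using assms(4) by simp
  finally show ?thesis .
qed

text \<open>
  Kruskal-Katona in Lovasz' form, at integer parameters, following Keevash: the cliques through a vertex
  \<open>v\<close> are bounded by induction in the link of \<open>v\<close> if \<open>v\<close> has small degree, and by the number of edges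
  avoiding \<open>v\<close> otherwise.
\<close>
theorem card_cliques_le:
  assumes "1 \<le> k" "finite V" "A \<subseteq> [V]\<^bsup>k\<^esup>" "B \<subseteq> [V]\<^bsup>Suc k\<^esup>" "facets_in B A" "card A \<le> N choose k"
  shows "Suc k * card B \<le> (N - k) * card A"
  using assms
proof (induction k arbitrary: N A B rule: nat_induct_at_least)
  case base
  then show ?case using card_pairs_le[of V A B N] by (simp add: numeral_2_eq_2)
next
  case (Suc k)
  note V = \<open>finite V\<close> and A = \<open>A \<subseteq> [V]\<^bsup>Suc k\<^esup>\<close> and B = \<open>B \<subseteq> [V]\<^bsup>Suc (Suc k)\<^esup>\<close>
  note facets = \<open>facets_in B A\<close> and card_A = \<open>card A \<le> N choose Suc k\<close>
  have "finite A" using finite_uniform[OF V A] .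
  show ?case
  proof (cases "Suc k \<le> N")
    case False
    then have "A = {}" using card_A \<open>finite A\<close> by (simp add: binomial_eq_0)
    moreover have "{} \<notin> B" using B by (auto simp: nsets_def)
    ultimately have "B = {}" using facets by (fastforce simp: facets_in_def)
    then show ?thesis by simp
  next
    case True
    then obtain M where N: "N = Suc M" by (cases N) auto
    have link_bound: "Suc k * card (link v B) \<le> (M - k) * card (link v A)" for v
    proof (cases "card (link v A) \<le> M choose k")
      case True
      then show ?thesis
        by (intro Suc.IH V link_uniform A B facets_in_link facets)
    next
      case False
      then show ?thesis
        using card_A by (intro card_link_le_of_high_degree[OF \<open>finite A\<close> facets]) (auto simp: N)
    qed
    have "Suc k * (\<Sum>v\<in>V. card (link v B)) \<le> (M - k) * (\<Sum>v\<in>V. card (link v A))"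
      unfolding sum_distrib_left by (intro sum_mono link_bound)
    then have "Suc k * (Suc (Suc k) * card B) \<le> Suc k * ((M - k) * card A)"
      unfolding sum_card_link[OF V A] sum_card_link[OF V B] by (simp only: mult.left_commute)
    then show ?thesis unfolding N by (metis Suc_mult_le_cancel1 diff_Suc_Suc)
  qed
qed

definition down_closed :: "'a set set \<Rightarrow> bool" where
  "down_closed D \<longleftrightarrow> (\<forall>S T. T \<in> D \<longrightarrow> S \<subseteq> T \<longrightarrow> S \<in> D)"

lemma down_closedD: "down_closed D \<Longrightarrow> T \<in> D \<Longrightarrow> S \<subseteq> T \<Longrightarrow> S \<in> D"
  unfolding down_closed_def by blast

lemma card_next_level_le:
  assumes "down_closed D" "finite X" "1 \<le> j" "card (D \<inter> [X]\<^bsup>j\<^esup>) \<le> N choose j"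
  shows "Suc j * card (D \<inter> [X]\<^bsup>Suc j\<^esup>) \<le> (N - j) * card (D \<inter> [X]\<^bsup>j\<^esup>)"
proof (rule card_cliques_le[OF assms(3,2) _ _ _ assms(4)])
  show "facets_in (D \<inter> [X]\<^bsup>Suc j\<^esup>) (D \<inter> [X]\<^bsup>j\<^esup>)"
    unfolding facets_in_def nsets_def by (auto intro: down_closedD[OF assms(1)])
qed auto

lemma card_level_le:
  assumes D: "down_closed D" and X: "finite X" and "1 \<le> k" "k \<le> j"
    and "card (D \<inter> [X]\<^bsup>k\<^esup>) \<le> N choose k"
  shows "card (D \<inter> [X]\<^bsup>j\<^esup>) \<le> N choose j"
  using \<open>k \<le> j\<close>
proof (induction j rule: dec_induct)
  case (step j)
  have "Suc j * card (D \<inter> [X]\<^bsup>Suc j\<^esup>) \<le> (N - j) * card (D \<inter> [X]\<^bsup>j\<^esup>)"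
    using step \<open>1 \<le> k\<close> by (intro card_next_level_le[OF D X]) auto
  also have "\<dots> \<le> (N - j) * (N choose j)" using step.IH by (rule mult_le_mono2)
  also have "\<dots> = Suc j * (N choose Suc j)" by (rule Suc_times_choose_Suc[symmetric])
  finally show ?case by (metis Suc_mult_le_cancel1)
qed (rule assms)

lemma card_level_ratio:
  assumes D: "down_closed D" and X: "finite X" and "1 \<le> k" "k \<le> j"
    and "card (D \<inter> [X]\<^bsup>k\<^esup>) \<le> N choose k"
  shows "card (D \<inter> [X]\<^bsup>j\<^esup>) * (N choose k) \<le> card (D \<inter> [X]\<^bsup>k\<^esup>) * (N choose j)"
  using \<open>k \<le> j\<close>
proof (induction j rule: dec_induct)
  case (step j)
  have "Suc j * card (D \<inter> [X]\<^bsup>Suc j\<^esup>) \<le> (N - j) * card (D \<inter> [X]\<^bsup>j\<^esup>)"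
    using card_level_le[OF D X assms(3) step.hyps(1) assms(5)] step.hyps assms(3)
    by (intro card_next_level_le[OF D X]) auto
  then have "Suc j * (card (D \<inter> [X]\<^bsup>Suc j\<^esup>) * (N choose k))
      \<le> (N - j) * (card (D \<inter> [X]\<^bsup>j\<^esup>) * (N choose k))"
    unfolding mult.assoc[symmetric] by (rule mult_le_mono1)
  also have "\<dots> \<le> (N - j) * (card (D \<inter> [X]\<^bsup>k\<^esup>) * (N choose j))"
    using step.IH by (rule mult_le_mono2)
  also have "\<dots> = Suc j * (card (D \<inter> [X]\<^bsup>k\<^esup>) * (N choose Suc j))"
    using Suc_times_choose_Suc[of j N] by (metis mult.left_commute)
  finally show ?case by (metis Suc_mult_le_cancel1)
qed simp

definition shadow :: "nat \<Rightarrow> 'a set set \<Rightarrow> 'a set set" where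
  "shadow b \<A> = (\<Union>A\<in>\<A>. [A]\<^bsup>b\<^esup>)"

theorem card_shadow_ge:
  assumes Y: "finite Y" and \<A>: "\<A> \<subseteq> [Y]\<^bsup>a\<^esup>" and b: "1 \<le> b" "b \<le> a"
    and card_\<A>: "card \<A> \<le> N choose a"
  shows "card \<A> * (N choose b) \<le> card (shadow b \<A>) * (N choose a)"
proof -
  define D where "D = {T. \<exists>A\<in>\<A>. T \<subseteq> A}"
  have D: "down_closed D" unfolding D_def down_closed_def by blast
  have shadow: "shadow b \<A> = D \<inter> [Y]\<^bsup>b\<^esup>"
    using \<A> Y by (auto simp: shadow_def D_def nsets_def intro: finite_subset)
  show ?thesis
  proof (cases "card (D \<inter> [Y]\<^bsup>b\<^esup>) \<le> N choose b")
    case True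
    have "\<A> \<subseteq> D \<inter> [Y]\<^bsup>a\<^esup>" using \<A> by (auto simp: D_def)
    then have "card \<A> * (N choose b) \<le> card (D \<inter> [Y]\<^bsup>a\<^esup>) * (N choose b)"
      using Y by (intro mult_le_mono1 card_mono) (auto simp: finite_imp_finite_nsets)
    also have "\<dots> \<le> card (D \<inter> [Y]\<^bsup>b\<^esup>) * (N choose a)"
      by (rule card_level_ratio[OF D Y b True])
    finally show ?thesis by (simp add: shadow)
  next
    case False
    then have "(N choose b) * card \<A> \<le> card (D \<inter> [Y]\<^bsup>b\<^esup>) * (N choose a)"
      using card_\<A> by (intro mult_le_mono) auto
    then show ?thesis by (simp add: shadow mult.commute)
  qed
qed

section \<open>Biased measures\<close>

definition random_subset :: "real \<Rightarrow> 'a set \<Rightarrow> 'a set pmf" where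
  "random_subset p X = map_pmf (\<lambda>f. {x \<in> X. f x}) (Pi_pmf X False (\<lambda>_. bernoulli_pmf p))"

abbreviation biased_measure :: "real \<Rightarrow> 'a set \<Rightarrow> 'a set set \<Rightarrow> real" (\<open>\<mu>\<close>) where
  "\<mu> p X \<equiv> measure_pmf.prob (random_subset p X)"

definition up_closed :: "'a set set \<Rightarrow> bool" where
  "up_closed A \<longleftrightarrow> (\<forall>S T. S \<in> A \<longrightarrow> S \<subseteq> T \<longrightarrow> T \<in> A)"

definition upper_section :: "'a \<Rightarrow> 'a set set \<Rightarrow> 'a set set" where
  "upper_section x A = {S. insert x S \<in> A}"

lemma up_closedD: "up_closed A \<Longrightarrow> S \<in> A \<Longrightarrow> S \<subseteq> T \<Longrightarrow> T \<in> A"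
  unfolding up_closed_def by blast

lemma up_closed_upper_section: "up_closed A \<Longrightarrow> up_closed (upper_section x A)"
  by (subst up_closed_def) (auto simp: upper_section_def intro: up_closedD[OF _ _ Set.insert_mono])

lemma down_closed_upper_section: "down_closed A \<Longrightarrow> down_closed (upper_section x A)"
  by (subst down_closed_def) (auto simp: upper_section_def intro: down_closedD[OF _ _ Set.insert_mono])

lemma down_closed_Compl: "up_closed A \<Longrightarrow> down_closed (- A)"
  unfolding up_closed_def down_closed_def by blast

lemma set_pmf_random_subset: "set_pmf (random_subset p X) \<subseteq> Pow X"
  by (auto simp: random_subset_def)

lemma biased_measure_mono:
  assumes "Pow X \<inter> A \<subseteq> B"
  shows "\<mu> p X A \<le> \<mu> p X B"
proof (rule measure_pmf.finite_measure_mono_AE)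
  show "AE S in random_subset p X. S \<in> A \<longrightarrow> S \<in> B"
    using assms set_pmf_random_subset[of p X] by (auto simp: AE_measure_pmf_iff)
qed simp

lemma biased_measure_Compl: "\<mu> p X (- A) = 1 - \<mu> p X A"
  using measure_pmf.prob_compl[of A "random_subset p X"] by (simp add: Compl_eq_Diff_UNIV)

lemma biased_measure_empty: "\<mu> p {} A = (if {} \<in> A then 1 else 0)"
  by (simp add: random_subset_def indicator_def)

lemma random_subset_insert:
  assumes "finite X" "x \<notin> X"
  shows "random_subset p (insert x X) =
    bernoulli_pmf p \<bind> (\<lambda>b. map_pmf (if b then insert x else id) (random_subset p X))"
proof -
  have Collect_upd: "{y \<in> insert x X. (f(x := b)) y} = (if b then insert x else id) {y \<in> X. f y}" for f b
    using assms(2) by auto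
  show ?thesis
    unfolding random_subset_def Pi_pmf_insert'[OF assms]
    by (simp add: map_bind_pmf map_pmf_comp Collect_upd map_pmf_def[symmetric]
        del: insert_iff fun_upd_apply)
qed

lemma biased_measure_insert:
  assumes "0 \<le> p" "p \<le> 1" "finite X" "x \<notin> X"
  shows "\<mu> p (insert x X) A = p * \<mu> p X (upper_section x A) + (1 - p) * \<mu> p X A"
proof -
  let ?N = "\<lambda>b. map_pmf (if b then insert x else id) (random_subset p X)"
  have "\<mu> p (insert x X) A = (\<integral>b. measure_pmf.prob (?N b) A \<partial>bernoulli_pmf p)"
    unfolding random_subset_insert[OF assms(3,4)] measure_pmf_bind
    by (rule measure_pmf.measure_bind[where N = "count_space UNIV"])
       (auto simp: space_subprob_algebra measure_pmf.subprob_space_axioms)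
  also have "\<dots> = p * \<mu> p X (upper_section x A) + (1 - p) * \<mu> p X A"
    using assms by (simp add: upper_section_def vimage_def)
  finally show ?thesis .
qed

lemma biased_measure_remove:
  assumes "0 \<le> p" "p \<le> 1" "finite X" "x \<in> X"
  shows "\<mu> p X A = p * \<mu> p (X - {x}) (upper_section x A) + (1 - p) * \<mu> p (X - {x}) A"
  using biased_measure_insert[of p "X - {x}" x A] assms by (simp add: insert_absorb)

lemma biased_measure_le_upper_section:
  "up_closed A \<Longrightarrow> \<mu> p X A \<le> \<mu> p X (upper_section x A)"
  by (intro biased_measure_mono) (auto simp: upper_section_def intro: up_closedD[OF _ _ subset_insertI])

lemma biased_measure_upper_section_le:
  "down_closed A \<Longrightarrow> \<mu> p X (upper_section x A) \<le> \<mu> p X A"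
  by (intro biased_measure_mono) (auto simp: upper_section_def intro: down_closedD[OF _ _ subset_insertI])

lemma pmf_random_subset:
  assumes "0 \<le> p" "p \<le> 1" "finite X" "S \<subseteq> X"
  shows "pmf (random_subset p X) S = p ^ card S * (1 - p) ^ (card X - card S)"
proof -
  let ?f = "Pi_pmf X False (\<lambda>_. bernoulli_pmf p)"
  have "{x \<in> X. f x} = S \<longleftrightarrow> f = (\<lambda>x. x \<in> S)" if "f \<in> set_pmf ?f" for f
    using that set_Pi_pmf_subset[OF assms(3)] assms(4) by fastforce
  then have "pmf (random_subset p X) S = pmf ?f (\<lambda>x. x \<in> S)"
    unfolding random_subset_def pmf_map measure_pmf_single[symmetric]
    by (subst measure_map_pmf, intro measure_pmf.finite_measure_eq_AE) (auto simp: AE_measure_pmf_iff)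
  also have "\<dots> = (\<Prod>x\<in>X. pmf (bernoulli_pmf p) (x \<in> S))"
    using assms by (intro pmf_Pi') auto
  also have "\<dots> = (\<Prod>x\<in>X. if x \<in> S then p else 1 - p)"
    using assms by (intro prod.cong) auto
  also have "\<dots> = p ^ card S * (1 - p) ^ (card X - card S)"
    using assms by (simp add: prod.If_cases Int_absorb1 card_Diff_subset finite_subset flip: Diff_eq)
  finally show ?thesis .
qed

lemma biased_measure_levels:
  assumes "0 \<le> p" "p \<le> 1" "finite X"
  shows "\<mu> p X A = (\<Sum>j\<le>card X. p ^ j * (1 - p) ^ (card X - j) * card (A \<inter> [X]\<^bsup>j\<^esup>))"
proof -
  let ?w = "\<lambda>j. p ^ j * (1 - p) ^ (card X - j)"
  have "\<mu> p X A = \<mu> p X (Pow X \<inter> A)"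
    by (intro antisym biased_measure_mono) auto
  also have "\<dots> = (\<Sum>S\<in>Pow X \<inter> A. ?w (card S))"
    using assms by (subst measure_measure_pmf_finite) (auto simp: pmf_random_subset intro!: sum.cong)
  also have "\<dots> = (\<Sum>j\<le>card X. \<Sum>S\<in>{S \<in> Pow X \<inter> A. card S = j}. ?w (card S))"
    using assms by (intro sum.group[symmetric]) (auto intro: card_mono)
  also have "\<dots> = (\<Sum>j\<le>card X. \<Sum>S\<in>A \<inter> [X]\<^bsup>j\<^esup>. ?w j)"
    using assms by (intro sum.cong) (auto simp: nsets_def intro: finite_subset)
  finally show ?thesis by (simp add: mult.commute)
qed

lemma biased_measure_card:
  assumes "0 \<le> p" "p \<le> 1" "finite X"
  shows "\<mu> p X {S. P (card S)} = measure_pmf.prob (binomial_pmf (card X) p) {j. P j}"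
proof -
  have "binomial_pmf (card X) p = map_pmf card (random_subset p X)"
    using assms by (simp add: random_subset_def binomial_pmf_altdef'[of X _ p False] map_pmf_comp)
  then show ?thesis by (simp add: vimage_def)
qed

lemma biased_measure_tail_le:
  fixes p s :: real
  assumes "0 \<le> p" "p \<le> 1" "finite X" "X \<noteq> {}" "0 \<le> s" "real k + s \<le> card X * p"
  shows "\<mu> p X {S. card S < k} \<le> exp (- 2 * s\<^sup>2 / card X)"
proof -
  interpret binomial_distribution "card X" p
    using assms by unfold_locales auto
  have "\<mu> p X {S. card S < k} = measure_pmf.prob (binomial_pmf (card X) p) {j. j < k}"
    using assms by (intro biased_measure_card)
  also have "\<dots> \<le> measure_pmf.prob (binomial_pmf (card X) p) {j. j \<le> card X * p - s}"
    using assms by (intro measure_pmf.finite_measure_mono) auto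
  also have "\<dots> \<le> exp (- 2 * s\<^sup>2 / card X)"
    using assms by (intro prob_le) (auto simp: card_gt_0_iff)
  finally show ?thesis .
qed

lemma biased_measure_tail_remove:
  assumes "0 \<le> p" "p \<le> 1/2" "finite X" "x \<in> X"
  shows "\<mu> p (X - {x}) {S. card S < k} \<le> 2 * \<mu> p X {S. card S < k}"
proof -
  let ?tail = "{S :: 'a set. card S < k}"
  have "1/2 * \<mu> p (X - {x}) ?tail \<le> (1 - p) * \<mu> p (X - {x}) ?tail"
    using assms by (intro mult_right_mono) auto
  also have "\<dots> \<le> \<mu> p X ?tail"
    using assms biased_measure_remove[of p X x ?tail] by simp
  finally show ?thesis by simp
qed

lemma biased_measure_half_Diff:
  assumes "finite X"
  shows "\<mu> (1/2) X {S. X - S \<in> A} = \<mu> (1/2) X A"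
proof -
  have half: "random_subset (1/2) X = pmf_of_set (Pow X)"
    unfolding random_subset_def by (rule pmf_of_set_Pow_conv_bernoulli[OF assms])
  have "bij_betw (\<lambda>S. X - S) (Pow X) (Pow X)"
    by (rule bij_betw_byWitness[where f' = "\<lambda>S. X - S"]) (auto simp: double_diff)
  then have "random_subset (1/2) X = map_pmf (\<lambda>S. X - S) (random_subset (1/2) X)"
    unfolding half using assms by (subst map_pmf_of_set_bij_betw) auto
  then have "\<mu> (1/2) X A = measure_pmf.prob (map_pmf (\<lambda>S. X - S) (random_subset (1/2) X)) A"
    by simp
  then show ?thesis by (simp add: vimage_def)
qed

section \<open>Correlation and influence\<close>

theorem harris_inequality:
  assumes "0 \<le> p" "p \<le> 1" "finite X" "down_closed A" "down_closed B"
  shows "\<mu> p X A * \<mu> p X B \<le> \<mu> p X (A \<inter> B)"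
  using assms(3-5)
proof (induction X arbitrary: A B rule: finite_induct)
  case empty
  then show ?case by (simp add: biased_measure_empty)
next
  case (insert x X)
  define a1 a0 b1 b0 where "a1 = \<mu> p X (upper_section x A)" and "a0 = \<mu> p X A"
    and "b1 = \<mu> p X (upper_section x B)" and "b0 = \<mu> p X B"
  note defs = a1_def a0_def b1_def b0_def
  have section_le: "a1 \<le> a0" "b1 \<le> b0"
    unfolding defs using insert.prems by (auto intro: biased_measure_upper_section_le)
  have "(p * a1 + (1 - p) * a0) * (p * b1 + (1 - p) * b0)
      = p * (a1 * b1) + (1 - p) * (a0 * b0) - p * (1 - p) * ((a0 - a1) * (b0 - b1))"
    by algebra
  also have "\<dots> \<le> p * (a1 * b1) + (1 - p) * (a0 * b0)"
    using section_le assms(1,2) by simp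
  also have "\<dots> \<le> p * \<mu> p X (upper_section x A \<inter> upper_section x B) + (1 - p) * \<mu> p X (A \<inter> B)"
    unfolding defs using assms(1,2) insert.prems
    by (intro add_mono mult_left_mono insert.IH down_closed_upper_section) auto
  also have "upper_section x A \<inter> upper_section x B = upper_section x (A \<inter> B)"
    by (auto simp: upper_section_def)
  finally show ?case
    using insert.hyps assms(1,2) by (simp add: biased_measure_insert defs)
qed

lemma harris_inequality_INT:
  assumes "0 \<le> p" "p \<le> 1" "finite X" "finite I" "\<And>i. i \<in> I \<Longrightarrow> down_closed (D i)"
  shows "(\<Prod>i\<in>I. \<mu> p X (D i)) \<le> \<mu> p X (\<Inter>i\<in>I. D i)"
  using assms(4,5)
proof (induction I rule: finite_induct)
  case empty
  then show ?case by simp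
next
  case (insert i I)
  have down: "down_closed (\<Inter>i\<in>I. D i)"
    using insert.prems unfolding down_closed_def by blast
  have "(\<Prod>i\<in>insert i I. \<mu> p X (D i)) \<le> \<mu> p X (D i) * \<mu> p X (\<Inter>i\<in>I. D i)"
    using insert by (simp add: mult_left_mono)
  also have "\<dots> \<le> \<mu> p X (D i \<inter> (\<Inter>i\<in>I. D i))"
    using insert.prems down assms(1-3) by (intro harris_inequality) auto
  finally show ?case by simp
qed

definition influence :: "'a \<Rightarrow> 'a set \<Rightarrow> 'a set set \<Rightarrow> real" where
  "influence x X A = \<mu> (1/2) (X - {x}) (upper_section x A) - \<mu> (1/2) (X - {x}) A"

lemma influence_insert:
  assumes "finite X" "x \<notin> X" "y \<in> X"
  shows "influence y (insert x X) A = (influence y X (upper_section x A) + influence y X A) / 2"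
proof -
  have "insert x X - {y} = insert x (X - {y})" using assms by auto
  moreover have "upper_section x (upper_section y A) = upper_section y (upper_section x A)"
    by (simp add: upper_section_def insert_commute)
  ultimately show ?thesis
    using assms by (simp add: influence_def biased_measure_insert field_simps)
qed

theorem poincare_inequality:
  assumes "finite X" "up_closed A"
  shows "4 * \<mu> (1/2) X A * (1 - \<mu> (1/2) X A) \<le> (\<Sum>x\<in>X. influence x X A)"
  using assms
proof (induction X arbitrary: A rule: finite_induct)
  case empty
  then show ?case by (simp add: biased_measure_empty)
next
  case (insert x X)
  let ?A\<^sub>x = "upper_section x A"
  define u v where "u = \<mu> (1/2) X ?A\<^sub>x" and "v = \<mu> (1/2) X A"
  have uv: "v \<le> u" "u - v \<le> 1"
    unfolding u_def v_def
    by (simp_all add: biased_measure_le_upper_section[OF insert.prems] diff_le_eq add_increasing2)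
  have mean: "\<mu> (1/2) (insert x X) A = (u + v) / 2"
    using insert.hyps by (simp add: biased_measure_insert u_def v_def)
  have "4 * ((u + v) / 2) * (1 - (u + v) / 2)
      = (u - v) + (4 * u * (1 - u) + 4 * v * (1 - v)) / 2 - (u - v) * (1 - (u - v))"
    by (simp add: field_simps)
  also have "\<dots> \<le> (u - v) + (4 * u * (1 - u) + 4 * v * (1 - v)) / 2"
    using uv by simp
  also have "\<dots> \<le> (u - v) + ((\<Sum>y\<in>X. influence y X ?A\<^sub>x) + (\<Sum>y\<in>X. influence y X A)) / 2"
    using insert.IH[OF up_closed_upper_section[OF insert.prems, of x]] insert.IH[OF insert.prems]
    unfolding u_def v_def by (intro add_left_mono divide_right_mono add_mono) auto
  also have "\<dots> = influence x (insert x X) A + (\<Sum>y\<in>X. influence y (insert x X) A)"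
    using insert.hyps
    by (simp add: influence_insert influence_def[of x "insert x X"] u_def v_def
      flip: sum.distrib sum_divide_distrib)
  also have "\<dots> = (\<Sum>y\<in>insert x X. influence y (insert x X) A)"
    using insert.hyps by simp
  finally show ?case unfolding mean .
qed

section \<open>Measures of increasing families at different biases\<close>

lemma powr_add_one_diff_mono:
  fixes c x y :: real
  assumes "1 \<le> c" "0 < x" "x \<le> y"
  shows "(x + 1) powr c - x powr c \<le> (y + 1) powr c - y powr c"
proof (rule DERIV_nonneg_imp_nondecreasing[OF assms(3)])
  fix z assume "x \<le> z" "z \<le> y"
  then have "((\<lambda>z. (z + 1) powr c - z powr c) has_real_derivative
      c * (z + 1) powr (c - 1) - c * z powr (c - 1)) (at z)"
    using assms by (auto intro!: derivative_eq_intros)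
  moreover have "0 \<le> c * (z + 1) powr (c - 1) - c * z powr (c - 1)"
    using \<open>x \<le> z\<close> assms by (auto intro!: mult_left_mono powr_mono2)
  ultimately show "\<exists>d. ((\<lambda>z. (z + 1) powr c - z powr c) has_real_derivative d) (at z) \<and> 0 \<le> d"
    by blast
qed

lemma biased_mean_powr_le:
  fixes c u v :: real
  assumes "1 \<le> c" "0 \<le> v" "v \<le> u"
  shows "2 powr (-c) * u powr c + (1 - 2 powr (-c)) * v powr c \<le> ((u + v) / 2) powr c"
proof (cases "v = 0")
  case True
  then show ?thesis using assms by (simp add: powr_divide powr_minus field_simps)
next
  case False
  with assms have pos: "0 < v" "0 < u" by auto
  have "2 powr c - 1 \<le> (u / v + 1) powr c - (u / v) powr c"
    using powr_add_one_diff_mono[of c 1 "u / v"] assms pos by simp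
  then have "u powr c + (2 powr c - 1) * v powr c \<le> (u / v + 1) powr c * v powr c"
    using pos by (simp add: powr_divide field_simps)
  also have "\<dots> = (u + v) powr c"
  proof -
    have "u + v = (u / v + 1) * v" using pos by (simp add: field_simps)
    then show ?thesis using pos by (simp only: powr_mult)
  qed
  finally have "2 powr (-c) * (u powr c + (2 powr c - 1) * v powr c) \<le> 2 powr (-c) * (u + v) powr c"
    by (rule mult_left_mono) simp
  then show ?thesis
    using pos by (simp add: powr_divide powr_minus field_simps)
qed

lemma two_powr_minus_le_half: "1 \<le> c \<Longrightarrow> 2 powr (-c) \<le> (1/2 :: real)"
  using powr_mono[of "-c" "-1" 2] by (simp add: powr_minus)

theorem biased_measure_le_half_powr:
  fixes c :: real
  assumes "1 \<le> c" "finite X" "up_closed A"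
  shows "\<mu> (2 powr (-c)) X A \<le> \<mu> (1/2) X A powr c"
  using assms(2,3)
proof (induction X arbitrary: A rule: finite_induct)
  case empty
  then show ?case by (simp add: biased_measure_empty)
next
  case (insert x X)
  let ?p = "2 powr (-c) :: real"
  have p: "0 \<le> ?p" "?p \<le> 1" using two_powr_minus_le_half[OF assms(1)] by auto
  define u v where "u = \<mu> (1/2) X (upper_section x A)" and "v = \<mu> (1/2) X A"
  have "\<mu> ?p (insert x X) A \<le> ?p * u powr c + (1 - ?p) * v powr c"
    unfolding biased_measure_insert[OF p insert.hyps] u_def v_def using p insert.prems
    by (intro add_mono mult_left_mono insert.IH up_closed_upper_section) auto
  also have "\<dots> \<le> ((u + v) / 2) powr c"
    using biased_measure_le_upper_section[OF insert.prems]
    by (intro biased_mean_powr_le assms(1)) (auto simp: u_def v_def)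
  also have "(u + v) / 2 = \<mu> (1/2) (insert x X) A"
    using insert.hyps by (simp add: biased_measure_insert u_def v_def)
  finally show ?case .
qed

section \<open>Stability of intersecting families\<close>

lemma intersecting_sections_sum_le_1:
  assumes "finite X" "intersecting A"
  shows "\<mu> (1/2) (X - {x}) (upper_section x A) + \<mu> (1/2) (X - {x}) A \<le> 1"
proof -
  let ?Y = "X - {x}"
  have "\<mu> (1/2) ?Y (upper_section x A) \<le> \<mu> (1/2) ?Y (- {S. ?Y - S \<in> A})"
    using assms(2) unfolding intersecting_def upper_section_def
    by (intro biased_measure_mono) fastforce
  also have "\<dots> = 1 - \<mu> (1/2) ?Y A"
    using assms(1) by (simp add: biased_measure_Compl biased_measure_half_Diff)
  finally show ?thesis by simp
qed

lemma intersecting_biased_measure_half_le: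
  assumes "finite X" "intersecting A"
  shows "\<mu> (1/2) X A \<le> 1/2"
proof (cases "X = {}")
  case True
  have "{} \<notin> A" using assms(2) unfolding intersecting_def by blast
  then show ?thesis by (simp add: True biased_measure_empty)
next
  case False
  then obtain x where "x \<in> X" by blast
  then show ?thesis
    using intersecting_sections_sum_le_1[OF assms, of x] biased_measure_remove[of "1/2" X x A] assms(1)
    by simp
qed

theorem intersecting_biased_measure_le:
  fixes c :: real
  assumes "1 \<le> c" "finite X" "up_closed A" "intersecting A"
  shows "\<mu> (2 powr (-c)) X A \<le> 2 powr (-c)"
proof -
  have "\<mu> (2 powr (-c)) X A \<le> \<mu> (1/2) X A powr c"
    by (rule biased_measure_le_half_powr[OF assms(1-3)])
  also have "\<dots> \<le> (1/2) powr c"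
    using intersecting_biased_measure_half_le[OF assms(2,4)] assms(1) by (intro powr_mono2) auto
  finally show ?thesis by (simp add: powr_divide powr_minus field_simps)
qed

lemma powr_add_one_diff_bounds:
  fixes x c :: real
  assumes "0 < x" "1 \<le> c"
  shows "c * x powr (c - 1) \<le> (x + 1) powr c - x powr c"
    and "(x + 1) powr c - x powr c \<le> c * (x + 1) powr (c - 1)"
proof -
  have "\<exists>z>x. z < x + 1 \<and> (x + 1) powr c - x powr c = (x + 1 - x) * (c * z powr (c - 1))"
    using assms by (intro MVT2) (auto intro!: derivative_eq_intros)
  then obtain z where z: "x < z" "z < x + 1" "(x + 1) powr c - x powr c = c * z powr (c - 1)"
    by auto
  show "c * x powr (c - 1) \<le> (x + 1) powr c - x powr c"
    unfolding z(3) using z(1,2) assms by (intro mult_left_mono powr_mono2) auto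
  show "(x + 1) powr c - x powr c \<le> c * (x + 1) powr (c - 1)"
    unfolding z(3) using z(1,2) assms by (intro mult_left_mono powr_mono2) auto
qed

lemma powr_four_gap:
  fixes c :: real
  assumes "1 \<le> c"
  shows "(c - 1) / 3 \<le> 4 powr c - 3 powr c - 2 powr c + 1"
proof -
  define b where "b = (3/2 :: real) powr (c - 1)"
  have "(c - 1) / 3 \<le> (c - 1) * ln (3/2)"
    using assms ln_le_minus_one[of "2/3"] mult_left_mono[of "1/3" "ln (3/2)" "c - 1"] by (simp add: ln_div)
  also have "\<dots> \<le> b - 1"
    using exp_ge_add_one_self[of "(c - 1) * ln (3/2)"] by (simp add: b_def powr_def le_diff_eq add.commute)
  also have "\<dots> \<le> (c * 2 powr (c - 1)) * (b - 1)"
  proof -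
    have "1 * 1 \<le> c * 2 powr (c - 1)" "1 \<le> b"
      using assms unfolding b_def by (intro mult_mono ge_one_powr_ge_zero; simp)+
    then show ?thesis using mult_right_mono[of 1 "c * 2 powr (c - 1)" "b - 1"] by simp
  qed
  also have "\<dots> = c * 3 powr (c - 1) - c * 2 powr (c - 1)"
    by (simp add: b_def powr_divide field_simps)
  also have "\<dots> \<le> (4 powr c - 3 powr c) - (2 powr c - 1)"
    using powr_add_one_diff_bounds(1)[of 3 c] powr_add_one_diff_bounds(2)[of 1 c] assms by simp
  finally show ?thesis by simp
qed

lemma convex_on_powr_atLeast_0:
  fixes c :: real
  assumes "1 \<le> c"
  shows "convex_on {0..} (\<lambda>x. x powr c)"
proof (rule convex_on_linorderI)
  fix t x y :: real
  assume t: "0 < t" "t < 1" and xy: "x \<in> {0..}" "y \<in> {0..}" "x < y"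
  show "((1 - t) *\<^sub>R x + t *\<^sub>R y) powr c \<le> (1 - t) * x powr c + t * y powr c"
  proof (cases "x = 0")
    case True
    have "t powr c \<le> t" using t assms by (intro powr_le_one_le) auto
    then show ?thesis using True t xy by (simp add: powr_mult mult_right_mono)
  next
    case False
    then show ?thesis using convex_onD[OF powr_convex[OF assms], of t x y] t xy by simp
  qed
qed simp

text \<open>
  If the lower section of an increasing intersecting family has uniform measure \<open>v\<close>, then its
  upper section has uniform measure at most \<open>1 - v\<close>; this is the resulting bound on the
  \<open>2 powr (-c)\<close>-biased measure.
\<close>
definition section_bound :: "real \<Rightarrow> real \<Rightarrow> real" where
  "section_bound c v = 2 powr (-c) * (1 - v) powr c + (1 - 2 powr (-c)) * v powr c"

lemma section_bound_0: "section_bound c 0 = 2 powr (-c)"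
  by (simp add: section_bound_def)

lemma section_bound_half: "section_bound c (1/2) = 2 powr (-c)"
  by (simp add: section_bound_def powr_divide powr_minus field_simps)

lemma section_bound_quarter_le:
  fixes c :: real
  assumes "1 \<le> c" "c \<le> 2"
  shows "section_bound c (1/4) \<le> 2 powr (-c) - (c - 1) / 192"
proof -
  define p where "p = (2::real) powr (-c)"
  have p: "1/4 \<le> p"
    using powr_mono[of "-2" "-c" "2::real"] assms(2) by (simp add: p_def powr_minus)
  have "2 powr c * p = 1" by (simp add: p_def powr_minus)
  then have powr_2: "2 powr c = 1 / p" using p by (simp add: field_simps)
  have powr_4: "4 powr c = 1 / p ^ 2"
    using powr_mult[of 2 2 c] by (simp add: powr_2 power2_eq_square)
  have "(c - 1) / 192 = (1/4) ^ 3 * ((c - 1) / 3)" by (simp add: power_divide)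
  also have "\<dots> \<le> p ^ 3 * (4 powr c - 3 powr c - 2 powr c + 1)"
    using p powr_four_gap[OF assms(1)] assms(1) power_mono[OF p, of 3]
    by (intro mult_mono) auto
  also have "\<dots> = p - (p * (3 powr c * p ^ 2) + (1 - p) * p ^ 2)"
    using p by (simp add: powr_2 powr_4 field_simps eval_nat_numeral)
  also have "\<dots> = p - section_bound c (1/4)"
    by (simp add: section_bound_def powr_divide powr_4 p_def[symmetric])
  finally show ?thesis unfolding p_def by linarith
qed

lemma convex_on_section_bound:
  assumes "1 \<le> c"
  shows "convex_on {0..1} (section_bound c)"
proof -
  have powr: "convex_on {0..1} (\<lambda>v. v powr c)"
    by (rule convex_on_subset[OF convex_on_powr_atLeast_0[OF assms]]) auto
  moreover have "convex_on {0..1} (\<lambda>v. (1 - v) powr c)"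
  proof (rule convex_onI)
    fix t x y :: real
    assume "0 < t" "t < 1" "x \<in> {0..1}" "y \<in> {0..1}"
    moreover have "1 - ((1 - t) * x + t * y) = (1 - t) * (1 - x) + t * (1 - y)"
      by (simp add: algebra_simps)
    ultimately show "(1 - ((1 - t) *\<^sub>R x + t *\<^sub>R y)) powr c
        \<le> (1 - t) * (1 - x) powr c + t * (1 - y) powr c"
      using convex_onD[OF powr, of t "1 - x" "1 - y"] by simp
  qed simp
  ultimately show ?thesis
    unfolding section_bound_def using two_powr_minus_le_half[OF assms]
    by (intro convex_on_add convex_on_cmul) auto
qed

lemma section_bound_le:
  fixes c v :: real
  assumes c: "1 \<le> c" "c \<le> 2" and v: "0 \<le> v" "v \<le> 1/2"
  shows "section_bound c v \<le> 2 powr (-c) - min v (1/2 - v) * ((c - 1) / 48)"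
proof -
  note convex = convex_onD[OF convex_on_section_bound[OF c(1)]]
  note quarter = section_bound_quarter_le[OF c]
  show ?thesis
  proof (cases "v \<le> 1/4")
    case True
    have "section_bound c v \<le> (1 - 4 * v) * section_bound c 0 + 4 * v * section_bound c (1/4)"
      using convex[of "4 * v" 0 "1/4"] v True by simp
    also have "\<dots> \<le> (1 - 4 * v) * 2 powr (-c) + 4 * v * (2 powr (-c) - (c - 1) / 192)"
      using quarter v by (simp add: section_bound_0 mult_left_mono)
    also have "\<dots> = 2 powr (-c) - v * ((c - 1) / 48)" by (simp add: field_simps)
    finally show ?thesis using True by simp
  next
    case False
    have "section_bound c v \<le> (4 * v - 1) * section_bound c (1/2) + (2 - 4 * v) * section_bound c (1/4)"
      using convex[of "2 - 4 * v" "1/2" "1/4"] v False by (simp add: algebra_simps)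
    also have "\<dots> \<le> (4 * v - 1) * 2 powr (-c) + (2 - 4 * v) * (2 powr (-c) - (c - 1) / 192)"
      using quarter v by (simp add: section_bound_half mult_left_mono)
    also have "\<dots> = 2 powr (-c) - (1/2 - v) * ((c - 1) / 48)" by (simp add: field_simps)
    finally show ?thesis using False by (simp add: min_def)
  qed
qed

lemma lower_section_dichotomy:
  fixes c e :: real
  defines "p \<equiv> 2 powr (-c)"
  assumes c: "1 \<le> c" "c \<le> 2" and X: "finite X" "x \<in> X" and A: "up_closed A" "intersecting A"
    and large: "p - e \<le> \<mu> p X A"
  shows "min (\<mu> (1/2) (X - {x}) A) (1/2 - \<mu> (1/2) (X - {x}) A) * (c - 1) \<le> 48 * e"
proof -
  define u v where "u = \<mu> (1/2) (X - {x}) (upper_section x A)"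
    and "v = \<mu> (1/2) (X - {x}) A"
  have p: "0 \<le> p" "p \<le> 1" using two_powr_minus_le_half[OF c(1)] by (auto simp: p_def)
  have uv: "v \<le> u" "u + v \<le> 1"
    unfolding u_def v_def using biased_measure_le_upper_section[OF A(1)]
      intersecting_sections_sum_le_1[OF X(1) A(2)] by auto
  have "p - e \<le> p * \<mu> p (X - {x}) (upper_section x A) + (1 - p) * \<mu> p (X - {x}) A"
    using large biased_measure_remove[OF p X] by simp
  also have "\<dots> \<le> p * u powr c + (1 - p) * v powr c"
    unfolding u_def v_def using p c X A unfolding p_def
    by (intro add_mono mult_left_mono biased_measure_le_half_powr up_closed_upper_section) auto
  also have "\<dots> \<le> section_bound c v"
    unfolding section_bound_def p_def[symmetric] using uv p c
    by (intro add_right_mono mult_left_mono powr_mono2) (auto simp: u_def)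
  also have "\<dots> \<le> p - min v (1/2 - v) * ((c - 1) / 48)"
    unfolding p_def using uv by (intro section_bound_le[OF c]) (auto simp: v_def)
  finally show ?thesis by (simp add: v_def)
qed

theorem intersecting_stability:
  fixes c e :: real
  assumes c: "1 < c" "c \<le> 2" and X: "finite X" "X \<noteq> {}"
    and A: "up_closed A" "intersecting A"
    and large: "2 powr (-c) - e \<le> \<mu> (2 powr (-c)) X A"
    and small: "192 * real (card X) * e < c - 1"
  shows "\<exists>x\<in>X. \<mu> (1/2) (X - {x}) A \<le> 48 * e / (c - 1)"
proof (rule ccontr)
  assume no_star: "\<not> ?thesis"
  define t where "t = 48 * e / (c - 1)"
  define \<alpha> where "\<alpha> = \<mu> (1/2) X A"
  have lower: "1/2 - t \<le> \<mu> (1/2) (X - {x}) A" if "x \<in> X" for x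
    using lower_section_dichotomy[OF _ c(2) X(1) that A large] no_star that c
    by (auto simp: t_def not_le field_simps min_def split: if_splits)
  have influence_le: "influence x X A \<le> 2 * t" if "x \<in> X" for x
    using lower[OF that] intersecting_sections_sum_le_1[OF X(1) A(2), of x] by (simp add: influence_def)
  obtain x where x: "x \<in> X" using X by blast
  have \<alpha>_ge: "1/2 - t \<le> \<alpha>"
    using lower[OF x] biased_measure_remove[of "1/2" X x A]
      biased_measure_le_upper_section[OF A(1), of "1/2" "X - {x}" x] X x by (simp add: \<alpha>_def)
  have "\<alpha> \<le> 1/2" unfolding \<alpha>_def by (rule intersecting_biased_measure_half_le[OF X(1) A(2)])
  then have "2 * \<alpha> \<le> 4 * \<alpha> * (1 - \<alpha>)"
    using mult_left_mono[of "1/2" "1 - \<alpha>" "4 * \<alpha>"] by (simp add: \<alpha>_def)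
  also have "\<dots> \<le> (\<Sum>x\<in>X. influence x X A)"
    unfolding \<alpha>_def by (rule poincare_inequality[OF X(1) A(1)])
  also have "\<dots> \<le> 2 * card X * t"
    using sum_mono[OF influence_le] by (simp add: mult_ac)
  finally have \<alpha>_le: "2 * \<alpha> \<le> 2 * card X * t" .
  have card_times_t: "4 * card X * t < 1" using small c by (simp add: t_def field_simps)
  have "t < 1/4"
  proof (rule ccontr)
    assume "\<not> t < 1/4"
    moreover have "1 \<le> real (card X)" using X by (simp add: Suc_leI card_gt_0_iff)
    ultimately have "1 * (1/4) \<le> real (card X) * t" by (intro mult_mono) auto
    then show False using card_times_t by simp
  qed
  then show False using \<alpha>_ge \<alpha>_le card_times_t by linarith
qed

section \<open>Measures and levels\<close>

lemma card_level_le_scaled: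
  fixes \<theta> :: real
  assumes D: "down_closed D" "finite X" and k: "1 \<le> k" "k \<le> j" and \<theta>: "0 \<le> \<theta>" "\<theta> \<le> 1"
    and level: "card (D \<inter> [X]\<^bsup>k\<^esup>) \<le> \<theta> * (N choose k)"
  shows "card (D \<inter> [X]\<^bsup>j\<^esup>) \<le> \<theta> * (N choose j)"
proof -
  have "card (D \<inter> [X]\<^bsup>k\<^esup>) \<le> 1 * real (N choose k)"
    using level \<theta>(2) by (meson mult_right_mono of_nat_0_le_iff order_trans)
  then have level': "card (D \<inter> [X]\<^bsup>k\<^esup>) \<le> N choose k" by simp
  show ?thesis
  proof (cases "N choose k = 0")
    case True
    then have "N choose j = 0" using k by (simp add: binomial_eq_0_iff)
    then show ?thesis
      using card_level_le[OF D k level'] by (metis le_zero_eq mult_zero_right of_nat_0 order_refl)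
  next
    case False
    have "real (card (D \<inter> [X]\<^bsup>j\<^esup>)) * (N choose k) \<le> real (card (D \<inter> [X]\<^bsup>k\<^esup>)) * (N choose j)"
      using card_level_ratio[OF D k level'] by (metis of_nat_le_iff of_nat_mult)
    also have "\<dots> \<le> \<theta> * (N choose k) * (N choose j)"
      using level by (intro mult_right_mono) auto
    finally show ?thesis using False by (simp add: mult_ac)
  qed
qed

lemma sum_biased_binomial:
  fixes p :: real
  assumes "N \<le> n"
  shows "(\<Sum>j\<le>n. p ^ j * (1 - p) ^ (n - j) * (N choose j)) = (1 - p) ^ (n - N)"
proof -
  have "(\<Sum>j\<le>n. p ^ j * (1 - p) ^ (n - j) * (N choose j))
      = (\<Sum>j\<le>N. p ^ j * (1 - p) ^ (n - j) * (N choose j))"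
    using assms by (intro sum.mono_neutral_right) auto
  also have "\<dots> = (\<Sum>j\<le>N. (1 - p) ^ (n - N) * ((N choose j) * p ^ j * (1 - p) ^ (N - j)))"
    using assms by (intro sum.cong) (auto simp: mult_ac simp flip: power_add)
  also have "\<dots> = (1 - p) ^ (n - N) * (p + (1 - p)) ^ N"
    unfolding sum_distrib_left[symmetric] binomial_ring by simp
  finally show ?thesis by simp
qed

theorem biased_measure_down_closed_le:
  fixes \<theta> :: real
  assumes D: "down_closed D" "finite X" and "1 \<le> k" "N \<le> card X" and p: "0 \<le> p" "p \<le> 1"
    and \<theta>: "0 \<le> \<theta>" "\<theta> \<le> 1" and level: "card (D \<inter> [X]\<^bsup>k\<^esup>) \<le> \<theta> * (N choose k)"
  shows "\<mu> p X D \<le> \<mu> p X {S. card S < k} + \<theta> * (1 - p) ^ (card X - N)"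
proof -
  let ?tail = "{S. card S < k}"
  let ?w = "\<lambda>j. p ^ j * (1 - p) ^ (card X - j)"
  have upper_levels: "card ((D - ?tail) \<inter> [X]\<^bsup>j\<^esup>) \<le> \<theta> * (N choose j)" for j
  proof (cases "k \<le> j")
    case True
    then have "(D - ?tail) \<inter> [X]\<^bsup>j\<^esup> = D \<inter> [X]\<^bsup>j\<^esup>" by (auto simp: nsets_def)
    then show ?thesis using card_level_le_scaled[OF D \<open>1 \<le> k\<close> True \<theta> level] by simp
  next
    case False
    then have "(D - ?tail) \<inter> [X]\<^bsup>j\<^esup> = {}" by (auto simp: nsets_def)
    then show ?thesis using \<theta> by simp
  qed
  have "\<mu> p X D \<le> \<mu> p X (?tail \<union> (D - ?tail))"
    by (intro biased_measure_mono) auto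
  also have "\<dots> \<le> \<mu> p X ?tail + \<mu> p X (D - ?tail)"
    by (intro measure_Un_le) auto
  also have "\<mu> p X (D - ?tail) \<le> (\<Sum>j\<le>card X. ?w j * (\<theta> * (N choose j)))"
    unfolding biased_measure_levels[OF p D(2)]
    using p by (intro sum_mono mult_left_mono upper_levels) auto
  also have "\<dots> = \<theta> * (\<Sum>j\<le>card X. ?w j * (N choose j))"
    by (simp add: sum_distrib_left mult_ac)
  also have "\<dots> = \<theta> * (1 - p) ^ (card X - N)"
    by (simp only: sum_biased_binomial[OF assms(4)])
  finally show ?thesis by simp
qed

definition up_closure :: "'a set set \<Rightarrow> 'a set set" where
  "up_closure G = {S. \<exists>A\<in>G. A \<subseteq> S}"

lemma up_closed_up_closure: "up_closed (up_closure G)"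
  unfolding up_closed_def up_closure_def by blast

lemma up_closure_mono: "G \<subseteq> H \<Longrightarrow> up_closure G \<subseteq> up_closure H"
  unfolding up_closure_def by blast

lemma intersecting_up_closure: "intersecting G \<Longrightarrow> intersecting (up_closure G)"
  unfolding intersecting_def up_closure_def by blast

lemma up_closure_level:
  assumes "G \<subseteq> [X]\<^bsup>k\<^esup>"
  shows "up_closure G \<inter> [X]\<^bsup>k\<^esup> = G"
proof -
  have "A = S" if "A \<in> G" "A \<subseteq> S" "S \<in> [X]\<^bsup>k\<^esup>" for A S
    using that assms by (intro card_subset_eq) (auto simp: nsets_def)
  then show ?thesis using assms by (auto simp: up_closure_def)
qed

lemma card_le_up_closure_measure:
  assumes Y: "finite Y" and G: "G \<subseteq> [Y]\<^bsup>k\<^esup>" and "1 \<le> k" and p: "0 \<le> p" "p \<le> 1"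
  shows "card G \<le> (\<mu> p Y {S. card S < k} + \<mu> p Y (up_closure G)) * (card Y choose k)"
proof (cases "card Y choose k = 0")
  case True
  then have "[Y]\<^bsup>k\<^esup> = {}" using Y by (metis card_nsets card_0_eq finite_imp_finite_nsets)
  then show ?thesis using G by simp
next
  case False
  define d where "d = card G / (card Y choose k)"
  have "card G \<le> card Y choose k"
    using G Y by (metis card_mono card_nsets finite_imp_finite_nsets)
  then have d: "0 \<le> d" "d \<le> 1" using False by (auto simp: d_def divide_le_eq)
  have "- up_closure G \<inter> [Y]\<^bsup>k\<^esup> = [Y]\<^bsup>k\<^esup> - G"
    using up_closure_level[OF G] by blast
  then have "card (- up_closure G \<inter> [Y]\<^bsup>k\<^esup>) = (card Y choose k) - card G"
    using G Y by (simp add: card_Diff_subset finite_uniform)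
  then have "card (- up_closure G \<inter> [Y]\<^bsup>k\<^esup>) \<le> (1 - d) * (card Y choose k)"
    using \<open>card G \<le> card Y choose k\<close> False by (simp add: d_def field_simps of_nat_diff)
  then have "\<mu> p Y (- up_closure G) \<le> \<mu> p Y {S. card S < k} + (1 - d)"
    using biased_measure_down_closed_le[of "- up_closure G" Y k "card Y" p "1 - d"] d assms
    by (simp add: down_closed_Compl up_closed_up_closure)
  then have "d \<le> \<mu> p Y {S. card S < k} + \<mu> p Y (up_closure G)"
    by (simp add: biased_measure_Compl)
  then have "d * (card Y choose k)
      \<le> (\<mu> p Y {S. card S < k} + \<mu> p Y (up_closure G)) * (card Y choose k)"
    by (intro mult_right_mono) auto
  then show ?thesis using False by (simp add: d_def)
qed

section \<open>Unions of intersecting families\<close>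

locale intersecting_families =
  fixes X :: "'a set" and k r :: nat and I :: "'i set" and G :: "'i \<Rightarrow> 'a set set"
  assumes finite_ground: "finite X" and k_pos: "1 \<le> k"
    and finite_index: "finite I" and card_index: "card I \<le> r" and r_le: "r \<le> card X"
    and uniform: "i \<in> I \<Longrightarrow> G i \<subseteq> [X]\<^bsup>k\<^esup>"
    and intersecting: "i \<in> I \<Longrightarrow> intersecting (G i)"
begin

abbreviation covered :: "'a set set" where
  "covered \<equiv> \<Union>i\<in>I. G i"

abbreviation tail :: "real \<Rightarrow> real" where
  "tail p \<equiv> \<mu> p X {S. card S < k}"

lemma finite_family: "i \<in> I \<Longrightarrow> finite (G i)"
  using finite_uniform[OF finite_ground uniform] .

lemma uncovered_measure_le:
  assumes p: "0 \<le> p" "p \<le> 1"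
    and large: "(card X choose k) - (card X - r choose k) \<le> card covered"
  shows "\<mu> p X (\<Inter>i\<in>I. - up_closure (G i)) \<le> tail p + (1 - p) ^ r"
proof -
  let ?D = "\<Inter>i\<in>I. - up_closure (G i)"
  have "down_closed ?D"
    using down_closed_Compl[OF up_closed_up_closure] unfolding down_closed_def by blast
  have "?D \<inter> [X]\<^bsup>k\<^esup> = [X]\<^bsup>k\<^esup> - covered"
    using up_closure_level[OF uniform] by blast
  moreover have "covered \<subseteq> [X]\<^bsup>k\<^esup>" "finite covered"
    using uniform finite_index finite_family by auto
  ultimately have "card (?D \<inter> [X]\<^bsup>k\<^esup>) = (card X choose k) - card covered"
    by (simp add: card_Diff_subset)
  then have "card (?D \<inter> [X]\<^bsup>k\<^esup>) \<le> 1 * real (card X - r choose k)"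
    using large by simp
  from biased_measure_down_closed_le[OF \<open>down_closed ?D\<close> finite_ground k_pos _ p _ _ this]
  show ?thesis using r_le by simp
qed

lemma prod_le_uncovered_measure:
  assumes p: "0 \<le> p" "p \<le> 1" and i: "i \<in> I"
    and lower: "\<And>j. j \<in> I \<Longrightarrow> 1 - p \<le> \<mu> p X (- up_closure (G j))"
  shows "(1 - p) ^ (card I - 1) * \<mu> p X (- up_closure (G i))
    \<le> \<mu> p X (\<Inter>j\<in>I. - up_closure (G j))"
proof -
  let ?m = "\<lambda>j. \<mu> p X (- up_closure (G j))"
  have "(1 - p) ^ (card I - 1) = (\<Prod>j\<in>I - {i}. 1 - p)" using i finite_index by simp
  also have "\<dots> \<le> (\<Prod>j\<in>I - {i}. ?m j)" using lower p by (intro prod_mono) auto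
  finally have "(1 - p) ^ (card I - 1) * ?m i \<le> (\<Prod>j\<in>I - {i}. ?m j) * ?m i"
    by (rule mult_right_mono) simp
  also have "\<dots> = (\<Prod>j\<in>I. ?m j)"
    using i finite_index by (simp add: prod.remove mult.commute)
  also have "\<dots> \<le> \<mu> p X (\<Inter>j\<in>I. - up_closure (G j))"
    using p
    by (intro harris_inequality_INT finite_ground finite_index down_closed_Compl up_closed_up_closure)
  finally show ?thesis .
qed

lemma up_closure_measure_ge:
  fixes c :: real
  defines "p \<equiv> 2 powr (-c)"
  assumes c: "1 \<le> c" and i: "i \<in> I"
    and large: "(card X choose k) - (card X - r choose k) \<le> card covered"
  shows "p - 2 ^ r * tail p \<le> \<mu> p X (up_closure (G i))"
proof -
  let ?U = "\<lambda>i. up_closure (G i)"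
  define q where "q = (1 - p) ^ (card I - 1)"
  have p: "0 \<le> p" "p \<le> 1/2" "p \<le> 1" using two_powr_minus_le_half[OF c] by (auto simp: p_def)
  have "card I \<ge> 1" using i finite_index by (auto simp: Suc_le_eq card_gt_0_iff)
  have lower: "1 - p \<le> \<mu> p X (- ?U j)" if "j \<in> I" for j
    unfolding p_def biased_measure_Compl
    using intersecting_biased_measure_le[OF c finite_ground up_closed_up_closure
        intersecting_up_closure[OF intersecting[OF that]]] by simp
  have "q * \<mu> p X (- ?U i) \<le> \<mu> p X (\<Inter>j\<in>I. - ?U j)"
    unfolding q_def by (rule prod_le_uncovered_measure[OF p(1,3) i lower])
  also have "\<dots> \<le> tail p + (1 - p) ^ r" by (rule uncovered_measure_le[OF p(1,3) large])
  also have "\<dots> \<le> q * (2 ^ r * tail p) + q * (1 - p)"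
  proof (rule add_mono)
    have "(1/2) ^ r \<le> (1 - p) ^ r" using p by (intro power_mono) auto
    also have "\<dots> \<le> q" unfolding q_def using p card_index by (intro power_decreasing) auto
    finally have "1 \<le> q * 2 ^ r" by (simp add: power_one_over field_simps)
    then show "tail p \<le> q * (2 ^ r * tail p)"
      using mult_right_mono[of 1 "q * 2 ^ r" "tail p"] by simp
    have "(1 - p) ^ r \<le> (1 - p) ^ Suc (card I - 1)"
      using p card_index \<open>card I \<ge> 1\<close> by (intro power_decreasing) auto
    then show "(1 - p) ^ r \<le> q * (1 - p)" by (simp add: q_def mult.commute)
  qed
  finally have "q * \<mu> p X (- ?U i) \<le> q * (2 ^ r * tail p + (1 - p))"
    by (simp add: distrib_left)
  moreover have "0 < q" using p by (simp add: q_def)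
  ultimately have "\<mu> p X (- ?U i) \<le> 2 ^ r * tail p + (1 - p)"
    by (simp add: mult_le_cancel_left_pos)
  then show ?thesis by (simp add: biased_measure_Compl)
qed

lemma exists_center:
  fixes c :: real
  defines "p \<equiv> 2 powr (-c)"
  assumes c: "1 < c" "c \<le> 2" and "X \<noteq> {}" and i: "i \<in> I"
    and large: "(card X choose k) - (card X - r choose k) \<le> card covered"
    and small: "192 * real (card X) * (2 ^ r * tail p) < c - 1"
  shows "\<exists>x\<in>X. card (avoiding x (G i))
    \<le> (48 * (2 ^ r * tail p) / (c - 1) + 2 * tail p) * (card X - 1 choose k)"
proof -
  let ?U = "up_closure (G i)"
  have p: "0 \<le> p" "p \<le> 1/2" using two_powr_minus_le_half[of c] c by (auto simp: p_def)
  obtain x where x: "x \<in> X" "\<mu> (1/2) (X - {x}) ?U \<le> 48 * (2 ^ r * tail p) / (c - 1)"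
    using intersecting_stability[OF c finite_ground \<open>X \<noteq> {}\<close> up_closed_up_closure
        intersecting_up_closure[OF intersecting[OF i]]] up_closure_measure_ge[OF _ i large, of c] small c
    unfolding p_def by force
  let ?Y = "X - {x}"
  have "finite ?Y" using finite_ground by simp
  have "avoiding x (G i) \<subseteq> [?Y]\<^bsup>k\<^esup>"
    using uniform[OF i] by (auto simp: avoiding_def nsets_def)
  then have "card (avoiding x (G i)) \<le>
      (\<mu> p ?Y {S. card S < k} + \<mu> p ?Y (up_closure (avoiding x (G i)))) * (card ?Y choose k)"
    using p k_pos \<open>finite ?Y\<close> by (intro card_le_up_closure_measure) auto
  also have "\<dots> \<le> (2 * tail p + 48 * (2 ^ r * tail p) / (c - 1)) * (card ?Y choose k)"
  proof (intro mult_right_mono add_mono)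
    show "\<mu> p ?Y {S. card S < k} \<le> 2 * tail p"
      by (rule biased_measure_tail_remove[OF p finite_ground x(1)])
    let ?b = "\<mu> (1/2) ?Y ?U"
    have "\<mu> p ?Y (up_closure (avoiding x (G i))) \<le> \<mu> p ?Y ?U"
      using up_closure_mono[of "avoiding x (G i)" "G i"]
      by (intro biased_measure_mono) (auto simp: avoiding_def)
    also have "\<dots> \<le> ?b powr c"
      unfolding p_def using c \<open>finite ?Y\<close> by (intro biased_measure_le_half_powr up_closed_up_closure) auto
    also have "\<dots> \<le> ?b"
      using c by (cases "?b = 0") (auto intro!: powr_le_one_le simp: zero_less_measure_iff)
    also note x(2)
    finally show "\<mu> p ?Y (up_closure (avoiding x (G i))) \<le> 48 * (2 ^ r * tail p) / (c - 1)" .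
  qed auto
  finally show ?thesis using x(1) finite_ground by (auto simp: add.commute)
qed

end

lemma exists_bias:
  fixes n k :: nat
  assumes "1 \<le> k" "2 * k < n"
  obtains c :: real where "1 < c" "c \<le> 2" "1 / (2 * real n) \<le> c - 1"
    "2 powr (-c) = (real k / real n + 1/2) / 2"
proof -
  define p where "p = (real k / real n + 1/2) / 2"
  define c where "c = - log 2 p"
  have "real k / real n \<le> (real n - 1) / 2 / real n"
    using assms(2) by (intro divide_right_mono) auto
  also have "\<dots> = 1/2 - 1 / (2 * real n)" using assms(2) by (simp add: field_simps)
  finally have p: "1/4 < p" "2 * p \<le> 1 - 1 / (2 * real n)"
    using assms by (auto simp: p_def)
  have "1 / (2 * real n) \<le> - ln (2 * p)"
    using ln_le_minus_one[of "2 * p"] p by simp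
  also have "\<dots> \<le> - ln (2 * p) / ln 2"
  proof -
    have "0 \<le> - ln (2 * p)" using calculation by (rule order_trans[rotated]) simp
    then show ?thesis
      using ln_le_minus_one[of 2] mult_left_mono[of "ln 2" 1 "- ln (2 * p)"]
      by (subst pos_le_divide_eq) auto
  qed
  also have "\<dots> = c - 1"
    using p by (simp add: c_def log_def ln_mult field_simps)
  finally have c_ge: "1 / (2 * real n) \<le> c - 1" .
  moreover have "1 < c"
  proof -
    have "0 < 1 / (2 * real n)" using assms(2) by simp
    then show ?thesis using c_ge by linarith
  qed
  moreover have "c \<le> 2"
  proof -
    have "log 2 (1/4) \<le> log 2 p" using p by simp
    moreover have "log 2 (1/4::real) = -2"
      using log_powr_cancel[of 2 "-2"] by (simp add: powr_minus)
    ultimately show ?thesis by (simp add: c_def)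
  qed
  moreover have "2 powr (-c) = p" using p by (simp add: c_def)
  ultimately show thesis using that[of c] by (simp add: p_def)
qed

text \<open>The factor 400 absorbs the constants \<open>2 * 192\<close> and \<open>2 * 48 + 2\<close> of the stability argument.\<close>
definition error_bound :: "nat \<Rightarrow> nat \<Rightarrow> nat \<Rightarrow> real" where
  "error_bound r n k = 400 * 2 ^ r * real n ^ 2 * exp (- ((real n - 2 * real k)\<^sup>2 / (8 * real n)))"

lemma biased_measure_midpoint_tail_le:
  assumes "finite X" "2 * k < card X"
  defines "n \<equiv> card X"
  shows "\<mu> ((k / n + 1/2) / 2) X {S. card S < k} \<le> exp (- ((real n - 2 * real k)\<^sup>2 / (8 * real n)))"
proof -
  let ?p = "(real k / real n + 1/2) / 2"
  let ?s = "(real n - 2 * real k) / 4"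
  have n: "0 < real n" "2 * real k \<le> real n" using assms(2) by (auto simp: n_def)
  have "real k + ?s = card X * ?p" using n by (simp add: n_def[symmetric] field_simps)
  moreover have "?p \<le> 1" "X \<noteq> {}" using n assms(2) by (auto simp: field_simps)
  ultimately have "\<mu> ?p X {S. card S < k} \<le> exp (- 2 * ?s\<^sup>2 / card X)"
    using assms(1) n by (intro biased_measure_tail_le) auto
  then show ?thesis by (simp add: n_def[symmetric] power_divide)
qed

lemma stability_error_le:
  fixes n r :: nat and \<delta> T E :: real
  assumes n: "1 \<le> n" and T: "0 \<le> T" "T \<le> E" and \<delta>: "1 / (2 * real n) \<le> \<delta>"
  shows "48 * (2 ^ r * T) / \<delta> + 2 * T \<le> 400 * 2 ^ r * real n ^ 2 * E"
proof -
  have "0 < 1 / (2 * real n)" using n by simp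
  then have "0 < \<delta>" using \<delta> by (rule less_le_trans)
  then have "48 * (2 ^ r * T) / \<delta> \<le> 48 * (2 ^ r * T) / (1 / (2 * real n))"
    using \<delta> T n by (intro divide_left_mono mult_pos_pos) auto
  also have "\<dots> = 96 * (n * 2 ^ r) * T" by simp
  also have "\<dots> \<le> 96 * (n\<^sup>2 * 2 ^ r) * T"
    using T n by (intro mult_right_mono mult_left_mono) (auto simp: power2_eq_square)
  finally have "48 * (2 ^ r * T) / \<delta> \<le> 96 * (n\<^sup>2 * 2 ^ r) * T" .
  moreover have "1 * 1 \<le> real n ^ 2 * (2::real) ^ r" using n by (intro mult_mono) auto
  then have "2 * T \<le> 2 * (n\<^sup>2 * 2 ^ r) * T" using T by (intro mult_right_mono) auto
  ultimately have "48 * (2 ^ r * T) / \<delta> + 2 * T \<le> 98 * (n\<^sup>2 * 2 ^ r * T)"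
    by (simp add: mult_ac)
  also have "\<dots> \<le> 400 * (n\<^sup>2 * 2 ^ r * E)" using T by (intro mult_mono) auto
  finally show ?thesis by (simp add: mult_ac)
qed

lemma (in intersecting_families) exists_center_error_bound:
  defines "n \<equiv> card X"
  assumes "2 * k < n" and i: "i \<in> I"
    and large: "(n choose k) - (n - r choose k) \<le> card covered" and err: "error_bound r n k < 1"
  shows "\<exists>x\<in>X. card (avoiding x (G i)) \<le> error_bound r n k * (n - 1 choose k)"
proof -
  obtain c :: real where c: "1 < c" "c \<le> 2" "1 / (2 * real n) \<le> c - 1"
    and bias: "2 powr (-c) = (real k / real n + 1/2) / 2"
    using exists_bias k_pos assms(2) by blast
  let ?T = "tail (2 powr (-c))"
  let ?E = "exp (- ((real n - 2 * real k)\<^sup>2 / (8 * real n)))"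
  have n: "1 \<le> n" "X \<noteq> {}" using assms(2) by (auto simp: n_def)
  have tail_le: "?T \<le> ?E"
    unfolding bias n_def using biased_measure_midpoint_tail_le[OF finite_ground] assms(2) n_def by blast
  have "192 * n * (2 ^ r * ?T) * (2 * n) \<le> 192 * n * (2 ^ r * ?E) * (2 * n)"
    using tail_le by (intro mult_left_mono mult_right_mono) auto
  also have "\<dots> \<le> error_bound r n k" by (simp add: error_bound_def power2_eq_square)
  also note err
  finally have "192 * real n * (2 ^ r * ?T) < 1 / (2 * real n)" using n by (simp add: less_divide_eq)
  then have small: "192 * real n * (2 ^ r * ?T) < c - 1" using c(3) by simp
  obtain x where x: "x \<in> X"
    "card (avoiding x (G i)) \<le> (48 * (2 ^ r * ?T) / (c - 1) + 2 * ?T) * (n - 1 choose k)"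
    using exists_center[OF c(1,2) n(2) i] large small unfolding n_def by blast
  note x(2)
  also have "(48 * (2 ^ r * ?T) / (c - 1) + 2 * ?T) * (n - 1 choose k)
      \<le> error_bound r n k * (n - 1 choose k)"
    unfolding error_bound_def using stability_error_le[OF n(1) _ tail_le c(3)]
    by (intro mult_right_mono) auto
  finally show ?thesis using x(1) by blast
qed

section \<open>Exchanging exceptional sets\<close>

definition hitting :: "'a set \<Rightarrow> nat \<Rightarrow> 'a set \<Rightarrow> 'a set set" where
  "hitting X k R = {S \<in> [X]\<^bsup>k\<^esup>. S \<inter> R \<noteq> {}}"

definition kneser_neighbours :: "'a set \<Rightarrow> nat \<Rightarrow> 'a set set \<Rightarrow> 'a set set" where
  "kneser_neighbours Y b N = {T \<in> [Y]\<^bsup>b\<^esup>. \<exists>A\<in>N. T \<inter> A = {}}"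

lemma card_hitting:
  assumes "finite X" "R \<subseteq> X"
  shows "card (hitting X k R) = (card X choose k) - (card X - card R choose k)"
proof -
  have "hitting X k R = [X]\<^bsup>k\<^esup> - [X - R]\<^bsup>k\<^esup>"
    by (auto simp: hitting_def nsets_def)
  moreover have "card (X - R) = card X - card R"
    using assms by (simp add: card_Diff_subset finite_subset)
  ultimately show ?thesis
    using assms nsets_mono[of "X - R" X k] by (simp add: card_Diff_subset finite_imp_finite_nsets)
qed

lemma card_less_by_exchange:
  assumes fin: "finite St" "finite N" and exceptional: "F - St \<subseteq> N"
    and lost: "S \<subseteq> St" "S \<inter> F \<subseteq> N" and "card N < card S"
  shows "card F < card St"
proof -
  have "card F \<le> card (N \<union> (St - S))"
    using fin exceptional lost(2) by (intro card_mono) auto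
  also have "\<dots> \<le> card N + card (St - S)" by (rule card_Un_le)
  also have "card (St - S) = card St - card S"
    using fin lost(1) by (simp add: card_Diff_subset finite_subset)
  also have "card N + (card St - card S) < card St"
    using assms(6) card_mono[OF fin(1) lost(1)] by linarith
  finally show ?thesis .
qed

context intersecting_families
begin

text \<open>The vertex is \<open>x i\<close> if the centres are distinct, and otherwise a vertex of \<open>R\<close> that is no centre.\<close>
lemma exchange_vertex:
  assumes x: "\<And>j. j \<in> I \<Longrightarrow> x j \<in> R" and R: "finite R" "card I \<le> card R" and i: "i \<in> I"
  obtains y where "y \<in> R"
    "\<And>T. T \<in> kneser_neighbours (X - R) (k - 1) (avoiding (x i) (G i)) \<Longrightarrow> insert y T \<in> covered
      \<Longrightarrow> insert y T \<in> (\<Union>j\<in>I. avoiding (x j) (G j))"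
proof (cases "inj_on x I")
  case True
  show thesis
  proof (rule that[of "x i"])
    fix T assume T: "T \<in> kneser_neighbours (X - R) (k - 1) (avoiding (x i) (G i))"
      and "insert (x i) T \<in> covered"
    then obtain j where j: "j \<in> I" "insert (x i) T \<in> G j" by blast
    obtain A where "A \<in> G i" "insert (x i) T \<inter> A = {}"
      using T by (auto simp: kneser_neighbours_def avoiding_def)
    then have "insert (x i) T \<notin> G i" using intersecting[OF i] unfolding intersecting_def by blast
    then have "x j \<noteq> x i" using True i j by (auto dest: inj_onD)
    moreover have "x j \<notin> T" using x[OF j(1)] T by (auto simp: kneser_neighbours_def nsets_def)
    ultimately show "insert (x i) T \<in> (\<Union>j\<in>I. avoiding (x j) (G j))"
      using j by (auto simp: avoiding_def)
  qed (rule x[OF i])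
next
  case False
  then have "card (x ` I) < card I"
    using finite_index by (metis card_image_le eq_card_imp_inj_on le_neq_implies_less)
  then have "card (x ` I) < card R" using R(2) by simp
  then obtain y where y: "y \<in> R" "y \<notin> x ` I"
    using finite_index by (metis card_mono finite_imageI linorder_not_le subsetI)
  show thesis
  proof (rule that[OF y(1)])
    fix T assume T: "T \<in> kneser_neighbours (X - R) (k - 1) (avoiding (x i) (G i))"
      and "insert y T \<in> covered"
    then obtain j where j: "j \<in> I" "insert y T \<in> G j" by blast
    have "x j \<notin> T" using x[OF j(1)] T by (auto simp: kneser_neighbours_def nsets_def)
    then show "insert y T \<in> (\<Union>j\<in>I. avoiding (x j) (G j))"
      using j y by (auto simp: avoiding_def)
  qed
qed

lemma finite_hitting: "finite (hitting X k R)"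
  using finite_ground by (simp add: hitting_def finite_imp_finite_nsets)

lemma covered_Diff_hitting:
  assumes "\<And>i. i \<in> I \<Longrightarrow> x i \<in> R"
  shows "covered - hitting X k R \<subseteq> (\<Union>i\<in>I. avoiding (x i) (G i))"
  using uniform assms by (fastforce simp: hitting_def avoiding_def)

lemma card_covered_less:
  fixes x :: "'i \<Rightarrow> 'a"
  defines "N \<equiv> \<lambda>i. avoiding (x i) (G i)"
  assumes R: "R \<subseteq> X" "card I \<le> card R" and x: "\<And>i. i \<in> I \<Longrightarrow> x i \<in> R"
    and i: "i \<in> I" and max: "\<And>j. j \<in> I \<Longrightarrow> card (N j) \<le> card (N i)"
    and expansion: "card R * card (N i) < card (kneser_neighbours (X - R) (k - 1) (N i))"
  shows "card covered < card (hitting X k R)"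
proof -
  let ?T = "kneser_neighbours (X - R) (k - 1) (N i)"
  have "finite R" using finite_subset[OF R(1) finite_ground] .
  obtain y where y: "y \<in> R" "\<And>T. T \<in> ?T \<Longrightarrow> insert y T \<in> covered \<Longrightarrow> insert y T \<in> (\<Union>j\<in>I. N j)"
    using exchange_vertex[where x = x, OF x \<open>finite R\<close> R(2) i] unfolding N_def by blast
  have y_notin: "y \<notin> T" and insert_y: "insert y T \<in> hitting X k R" if "T \<in> ?T" for T
    using that y(1) R(1) k_pos by (auto simp: kneser_neighbours_def hitting_def nsets_def card_insert_if)
  show ?thesis
  proof (rule card_less_by_exchange[OF finite_hitting])
    show "finite (\<Union>j\<in>I. N j)"
      using finite_index finite_family by (simp add: N_def avoiding_def)
    show "covered - hitting X k R \<subseteq> (\<Union>j\<in>I. N j)"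
      unfolding N_def by (rule covered_Diff_hitting[OF x])
    show "insert y ` ?T \<subseteq> hitting X k R"
      using insert_y by blast
    show "insert y ` ?T \<inter> covered \<subseteq> (\<Union>j\<in>I. N j)" using y(2) by blast
    have "card (\<Union>j\<in>I. N j) \<le> (\<Sum>j\<in>I. card (N j))" by (rule card_UN_le[OF finite_index])
    also have "\<dots> \<le> card I * card (N i)" using sum_bounded_above[OF max] by simp
    also have "\<dots> \<le> card R * card (N i)" using R(2) by (rule mult_le_mono1)
    also note expansion
    also have "card ?T = card (insert y ` ?T)"
      using y_notin by (intro card_image[symmetric] inj_onI) (metis insert_ident)
    finally show "card (\<Union>j\<in>I. N j) < card (insert y ` ?T)" .
  qed
qed

lemma covered_eq_hitting:
  assumes R: "R \<subseteq> X" "card I \<le> card R" and x: "\<And>i. i \<in> I \<Longrightarrow> x i \<in> R"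
    and large: "card (hitting X k R) \<le> card covered"
    and expansion: "\<And>i. i \<in> I \<Longrightarrow> avoiding (x i) (G i) \<noteq> {} \<Longrightarrow>
      card R * card (avoiding (x i) (G i))
        < card (kneser_neighbours (X - R) (k - 1) (avoiding (x i) (G i)))"
  shows "covered = hitting X k R"
proof (cases "\<forall>i\<in>I. avoiding (x i) (G i) = {}")
  case True
  then have "covered \<subseteq> hitting X k R" using covered_Diff_hitting[where x = x, OF x] by blast
  then show ?thesis using large finite_hitting by (meson card_seteq)
next
  case False
  let ?N = "\<lambda>i. avoiding (x i) (G i)"
  have finite_N: "finite (?N i)" if "i \<in> I" for i
    using finite_family[OF that] by (simp add: avoiding_def)
  from False obtain i\<^sub>0 where i\<^sub>0: "i\<^sub>0 \<in> I" "?N i\<^sub>0 \<noteq> {}" by blast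
  have "\<forall>j. j \<in> I \<longrightarrow> card (?N j) < Suc (card (\<Union>j\<in>I. ?N j))"
    using finite_N finite_index by (intro allI impI le_imp_less_Suc card_mono) auto
  with i\<^sub>0(1) have "\<exists>i. i \<in> I \<and> (\<forall>j. j \<in> I \<longrightarrow> card (?N j) \<le> card (?N i))"
    by (rule ex_has_greatest_nat)
  then obtain i where i: "i \<in> I" and max: "\<And>j. j \<in> I \<Longrightarrow> card (?N j) \<le> card (?N i)"
    by auto
  have "0 < card (?N i\<^sub>0)" using i\<^sub>0 finite_N by (simp add: card_gt_0_iff)
  then have "?N i \<noteq> {}" using max[OF i\<^sub>0(1)] by auto
  then have "card covered < card (hitting X k R)"
    using card_covered_less[where x = x, OF R x i] max expansion[OF i] by blast
  then show ?thesis using large by simp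
qed

end

section \<open>Ratios of binomial coefficients\<close>

lemma binomial_diff_both_ge:
  fixes b :: real
  assumes "0 \<le> b" "b * M \<le> real j - real u" "u \<le> j" "j \<le> M"
  shows "b ^ u * (M choose j) \<le> (M - u choose (j - u))"
  using assms(2,3)
proof (induction u)
  case (Suc u)
  define M' j' where "M' = M - Suc u" and "j' = j - Suc u"
  have eqs: "M - u = Suc M'" "j - u = Suc j'" using Suc.prems assms(4) by (auto simp: M'_def j'_def)
  have "b * real (Suc M') \<le> b * M" using assms(1) eqs by (intro mult_left_mono) auto
  also have "\<dots> \<le> real (Suc j')" using Suc.prems eqs by linarith
  finally have "b * real (Suc M') * (Suc M' choose Suc j') \<le> real (Suc j') * (Suc M' choose Suc j')"
    by (intro mult_right_mono) auto
  also have "\<dots> = real (Suc M') * (M' choose j')"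
    by (metis Suc_times_binomial of_nat_mult)
  finally have "b * (Suc M' choose Suc j') \<le> (M' choose j')"
    by (simp add: mult_ac mult_le_cancel_left_pos del: of_nat_Suc binomial_Suc_Suc)
  moreover have "b ^ Suc u * (M choose j) \<le> b * (Suc M' choose Suc j')"
    using mult_left_mono[OF Suc.IH assms(1)] Suc.prems by (simp add: eqs mult.assoc)
  ultimately show ?case unfolding M'_def j'_def by linarith
qed simp

lemma binomial_diff_top_ge:
  fixes b :: real
  assumes "0 \<le> b" "b * M \<le> real M - real w - real j" "j + w \<le> M"
  shows "b ^ w * (M choose j) \<le> (M - w choose j)"
proof -
  have "b ^ w * (M choose (M - j)) \<le> (M - w choose (M - j - w))"
    using assms by (intro binomial_diff_both_ge) auto
  moreover have "M choose (M - j) = M choose j" "M - w choose (M - j - w) = M - w choose j"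
    using assms(3) binomial_symmetric[of j M] binomial_symmetric[of j "M - w"]
    by (simp_all add: add.commute)
  ultimately show ?thesis by simp
qed

lemma binomial_ratio_growth:
  fixes g :: real
  assumes g: "1 \<le> g" "g * (real M - real a) \<le> real M - real b" and s: "a + s \<le> M" and "b \<le> a"
  shows "g ^ s * (M choose b) * (M - s choose a) \<le> (M - s choose b) * real (M choose a)"
  using s
proof (induction s)
  case (Suc s)
  define m where "m = M - Suc s"
  have m: "M - s = Suc m" "a \<le> Suc m" "b \<le> Suc m" using Suc.prems \<open>b \<le> a\<close> by (auto simp: m_def)
  have absorb: "real (Suc m) * (m choose i) = (real (Suc m) - real i) * (Suc m choose i)"
    if "i \<le> Suc m" for i
    using that binomial_absorb_comp[of "Suc m" i] by (metis diff_Suc_1 of_nat_diff of_nat_mult)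
  have g_step: "g * (real (Suc m) - real a) \<le> real (Suc m) - real b"
  proof -
    have "real (Suc m) = real M - real s" using m(1) Suc.prems by linarith
    then have "g * (real (Suc m) - real a) = g * (real M - real a) - g * real s"
      by (simp only:) (simp add: algebra_simps)
    moreover have "real s \<le> g * real s" using mult_right_mono[OF g(1), of "real s"] by simp
    ultimately show ?thesis using g(2) \<open>real (Suc m) = real M - real s\<close> by linarith
  qed
  have "real (Suc m) * (g ^ Suc s * (M choose b) * (m choose a))
      = (g * (real (Suc m) - real a)) * (g ^ s * (M choose b) * (Suc m choose a))"
    using absorb[OF m(2)] by (simp add: mult_ac del: of_nat_Suc)
  also have "\<dots> \<le> (real (Suc m) - real b) * ((Suc m choose b) * real (M choose a))"
    using g m Suc.IH Suc.prems by (intro mult_mono[OF g_step]) auto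
  also have "\<dots> = real (Suc m) * ((m choose b) * real (M choose a))"
    using absorb[OF m(3)] by (simp only: mult.assoc[symmetric])
  finally show ?case
    unfolding m_def[symmetric] by (subst (asm) mult_le_cancel_left_pos) auto
qed simp

lemma binomial_reference_ge:
  assumes q: "q < r" and s: "2 * (s + r) \<le> k" and n: "2 * k + 2 * r \<le> n"
  shows "(k / (2 * real n)) ^ (s + r) * (n - 1 choose k) \<le> (n - r - s choose (k - q - s))"
proof -
  define \<beta> where "\<beta> = k / (2 * real n)"
  define w u where "w = r - 1 - q" and "u = s + q"
  have "0 < n" using q n by simp
  have \<beta>: "0 \<le> \<beta>" "\<beta> \<le> 1" "\<beta> * n = k / 2" using n \<open>0 < n\<close> by (auto simp: \<beta>_def divide_le_eq)
  have \<beta>_mult_le: "\<beta> * M \<le> k / 2" if "M \<le> n" for M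
    unfolding \<beta>(3)[symmetric] using \<beta>(1) that by (intro mult_left_mono) auto
  have "\<beta> ^ (s + r) * (n - 1 choose k) \<le> \<beta> ^ (u + w) * (n - 1 choose k)"
    using \<beta> q by (intro mult_right_mono power_decreasing) (auto simp: u_def w_def)
  also have "\<dots> = \<beta> ^ u * (\<beta> ^ w * (n - 1 choose k))" by (simp add: power_add)
  also have "\<dots> \<le> \<beta> ^ u * (n - 1 - w choose k)"
  proof (intro mult_left_mono binomial_diff_top_ge \<beta>(1))
    show "\<beta> * real (n - 1) \<le> real (n - 1) - real w - real k"
      using \<beta>_mult_le[of "n - 1"] q n by (simp add: w_def)
  qed (use \<beta> q n in \<open>auto simp: w_def\<close>)
  also have "\<dots> \<le> (n - 1 - w - u choose (k - u))"
  proof (intro binomial_diff_both_ge \<beta>(1))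
    show "\<beta> * real (n - 1 - w) \<le> real k - real u"
      using \<beta>_mult_le[of "n - 1 - w"] q s by (simp add: u_def)
  qed (use q s n in \<open>auto simp: u_def w_def\<close>)
  also have "(n - 1 - w - u choose (k - u)) = (n - r - s choose (k - q - s))"
    using q by (simp add: w_def u_def add.commute)
  finally show ?thesis by (simp add: \<beta>_def)
qed

lemma binomial_below_le:
  assumes "1 \<le> k" "2 * k \<le> M" "M \<le> n"
  shows "real k / real n * (M choose (k - q)) \<le> (M choose (k - 1))"
proof (cases "q = 0")
  case True
  have "k * (M choose k) = (M - (k - 1)) * (M choose (k - 1))"
    using Suc_times_choose_Suc[of "k - 1" M] assms(1) by simp
  also have "\<dots> \<le> n * (M choose (k - 1))" using assms(3) by (intro mult_right_mono) auto
  finally have "real k * (M choose k) \<le> n * (M choose (k - 1))"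
    by (metis of_nat_le_iff of_nat_mult)
  then show ?thesis using True assms by (simp add: field_simps)
next
  case False
  have "real k / real n * (M choose (k - q)) \<le> 1 * real (M choose (k - 1))"
    using False assms by (intro mult_mono of_nat_mono binomial_mono) auto
  then show ?thesis by simp
qed

lemma binomial_expansion_gt:
  fixes m :: real
  assumes q: "q < r" and s: "2 * (s + r) \<le> k" and n: "2 * k + 2 * r \<le> n"
    and growth: "m < (n / (2 * real k)) ^ s * (k / real n)"
  defines "a \<equiv> n - r - (k - q)"
  shows "m * (n - r - s choose a) < (n - r - s choose (k - 1))"
proof -
  define g where "g = n / (2 * real k)"
  let ?P = "real (n - r - s choose a)" and ?Q = "real (n - r choose a)"
  have kn_pos: "0 < k" "0 < n" using q s n by auto
  have g: "1 \<le> g" using n kn_pos by (simp add: g_def)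
  have a: "k - 1 \<le> a" "a + s \<le> n - r" "a \<le> n - r" using q s n by (auto simp: a_def)
  have "g * (real (n - r) - real a) = g * real (k - q)" using q s n by (auto simp: a_def)
  also have "\<dots> \<le> g * k" using g by (intro mult_left_mono) auto
  also have "\<dots> = n / 2" using kn_pos by (simp add: g_def)
  also have "\<dots> \<le> real (n - r) - real (k - 1)" using n kn_pos by auto
  finally have ratio: "g ^ s * (n - r choose (k - 1)) * ?P \<le> (n - r - s choose (k - 1)) * ?Q"
    using g a by (intro binomial_ratio_growth) auto
  have "n - r choose a = n - r choose (k - q)"
    using q s n by (subst binomial_symmetric) (auto simp: a_def)
  then have below: "k / n * ?Q \<le> (n - r choose (k - 1))"
    using binomial_below_le[of k "n - r" n q] n kn_pos by simp
  have pos: "0 < ?P" "0 < ?Q" using a by simp_all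
  have "m * ?P * ?Q < g ^ s * (k / real n) * ?P * ?Q"
    using growth pos unfolding g_def by (intro mult_strict_right_mono) auto
  also have "\<dots> = g ^ s * ?P * (k / n * ?Q)" by (simp add: mult_ac)
  also have "\<dots> \<le> g ^ s * ?P * (n - r choose (k - 1))"
    using g below by (intro mult_left_mono) auto
  also have "\<dots> \<le> (n - r - s choose (k - 1)) * ?Q" using ratio by (simp add: mult_ac)
  finally show ?thesis using pos(2) by (simp add: mult_less_cancel_right_pos)
qed

section \<open>Expansion of the exceptional sets\<close>

definition trace_class :: "'a set \<Rightarrow> 'a set \<Rightarrow> 'a set set \<Rightarrow> 'a set set" where
  "trace_class R Q N = {A \<in> N. A \<inter> R = Q}"

lemma exists_popular_trace:
  assumes "finite N" "finite R"
  shows "\<exists>Q\<subseteq>R. card N \<le> 2 ^ card R * card (trace_class R Q N)"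
proof (rule ccontr)
  assume unpopular: "\<not> ?thesis"
  have "(\<Sum>Q\<in>Pow R. card (trace_class R Q N)) = card N"
    using sum.group[OF assms(1), of "Pow R" "\<lambda>A. A \<inter> R" "\<lambda>_. 1::nat"] assms(2)
    by (auto simp: trace_class_def)
  then have "2 ^ card R * card N = (\<Sum>Q\<in>Pow R. 2 ^ card R * card (trace_class R Q N))"
    by (simp flip: sum_distrib_left)
  also have "\<dots> < (\<Sum>Q\<in>Pow R. card N)"
    using unpopular assms(2) by (intro sum_strict_mono) (auto simp: not_le)
  also have "\<dots> = 2 ^ card R * card N" using assms(2) by (simp add: card_Pow)
  finally show False by simp
qed

lemma kneser_neighbours_eq_shadow:
  assumes "finite Y"
  shows "kneser_neighbours Y b N = shadow b ((\<lambda>A. Y - A) ` N)"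
  using assms by (auto simp: kneser_neighbours_def shadow_def nsets_def intro: finite_subset)

lemma kneser_neighbours_mono: "M \<subseteq> N \<Longrightarrow> kneser_neighbours Y b M \<subseteq> kneser_neighbours Y b N"
  by (auto simp: kneser_neighbours_def)

lemma inj_on_complement_of_trace:
  assumes "N \<subseteq> [X]\<^bsup>k\<^esup>"
  shows "inj_on (\<lambda>A. X - R - A) (trace_class R Q N)"
proof (rule inj_onI)
  fix A B
  assume AB: "A \<in> trace_class R Q N" "B \<in> trace_class R Q N" "X - R - A = X - R - B"
  have "A \<subseteq> X" "B \<subseteq> X" using AB(1,2) assms by (auto simp: trace_class_def nsets_def)
  then have "A = Q \<union> (X - R - (X - R - A))" "B = Q \<union> (X - R - (X - R - B))"
    using AB(1,2) unfolding trace_class_def by blast+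
  then show "A = B" using AB(3) by metis
qed

lemma complement_of_trace_uniform:
  assumes "finite X" "R \<subseteq> X" "N \<subseteq> [X]\<^bsup>k\<^esup>"
  shows "(\<lambda>A. X - R - A) ` trace_class R Q N \<subseteq> [X - R]\<^bsup>(card X - card R - (k - card Q))\<^esup>"
proof (rule image_subsetI)
  fix A assume A: "A \<in> trace_class R Q N"
  have "finite R" using assms(1,2) finite_subset by blast
  have "A \<subseteq> X" "card A = k" "finite A" "A \<inter> R = Q"
    using A assms(3) by (auto simp: trace_class_def nsets_def)
  then have "card (A - R) = k - card Q"
    using \<open>finite R\<close> by (metis card_Diff_subset_Int finite_Int)
  moreover have "X - R - A = X - R - (A - R)" "A - R \<subseteq> X - R" using \<open>A \<subseteq> X\<close> by auto
  ultimately have "card (X - R - A) = card X - card R - (k - card Q)"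
    using assms(1,2) \<open>finite A\<close> \<open>finite R\<close> by (simp add: card_Diff_subset)
  then show "X - R - A \<in> [X - R]\<^bsup>(card X - card R - (k - card Q))\<^esup>"
    using assms(1) by (simp add: nsets_def)
qed

lemma card_kneser_neighbours_ge:
  fixes X R Q :: "'a set" and k :: nat
  defines "a \<equiv> card X - card R - (k - card Q)"
  assumes X: "finite X" "R \<subseteq> X" and N: "N \<subseteq> [X]\<^bsup>k\<^esup>" and b: "1 \<le> b" "b \<le> a"
    and small: "card (trace_class R Q N) \<le> P choose a"
  shows "card (trace_class R Q N) * (P choose b) \<le> card (kneser_neighbours (X - R) b N) * (P choose a)"
proof -
  define M where "M = trace_class R Q N"
  define \<A> where "\<A> = (\<lambda>A. X - R - A) ` M"
  have "finite (X - R)" using X by simp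
  have card_\<A>: "card \<A> = card M"
    unfolding \<A>_def M_def by (rule card_image[OF inj_on_complement_of_trace[OF N]])
  have "\<A> \<subseteq> [X - R]\<^bsup>a\<^esup>"
    unfolding \<A>_def M_def a_def by (rule complement_of_trace_uniform[OF X N])
  then have "card \<A> * (P choose b) \<le> card (shadow b \<A>) * (P choose a)"
    using small b card_\<A> by (intro card_shadow_ge[OF \<open>finite (X - R)\<close>]) (auto simp: M_def)
  also have "shadow b \<A> = kneser_neighbours (X - R) b M"
    unfolding \<A>_def by (rule kneser_neighbours_eq_shadow[OF \<open>finite (X - R)\<close>, symmetric])
  also have "card \<dots> * (P choose a) \<le> card (kneser_neighbours (X - R) b N) * (P choose a)"
    using \<open>finite (X - R)\<close> by (intro mult_le_mono1 card_mono kneser_neighbours_mono)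
      (auto simp: kneser_neighbours_def finite_imp_finite_nsets M_def trace_class_def)
  finally show ?thesis by (simp add: card_\<A> M_def)
qed

text \<open>
  The members of \<open>N\<close> with the most popular trace on \<open>R\<close> are replaced by their complements in \<open>X - R\<close>,
  whose shadow is compared with that of all sets of the same size on \<open>n - r - s\<close> points.
\<close>
theorem card_kneser_neighbours_gt:
  fixes X R :: "'a set"
  defines "n \<equiv> card X" and "r \<equiv> card R"
  assumes X: "finite X" and R: "R \<subseteq> X" "x \<in> R" and N: "N \<subseteq> [X - {x}]\<^bsup>k\<^esup>" "N \<noteq> {}"
    and s: "2 * (s + r) \<le> k" and n: "2 * k + 2 * r \<le> n"
    and small: "card N \<le> (k / (2 * real n)) ^ (s + r) * (n - 1 choose k)"
    and growth: "real (r * 2 ^ r) < (n / (2 * real k)) ^ s * (k / real n)"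
  shows "r * card N < card (kneser_neighbours (X - R) (k - 1) N)"
proof -
  let ?Y = "X - R"
  have fin: "finite R" "finite N" "finite ?Y"
    using X R(1) finite_uniform[OF _ N(1)] by (auto intro: finite_subset)
  obtain Q where Q: "Q \<subseteq> R" "card N \<le> 2 ^ r * card (trace_class R Q N)"
    using exists_popular_trace[OF fin(2,1)] by (auto simp: r_def)
  define M where "M = trace_class R Q N"
  have M: "M \<subseteq> N" "card N \<le> 2 ^ r * card M" using Q(2) by (auto simp: M_def trace_class_def)
  have "card N > 0" using N(2) fin(2) by (simp add: card_gt_0_iff)
  then have "card M > 0" using M(2) by (cases "card M = 0") auto
  then obtain A where "A \<in> M" by fastforce
  then have "x \<notin> Q" using N(1) by (auto simp: M_def trace_class_def nsets_def)
  then have "Q \<subset> R" using R(2) Q(1) by blast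
  then have q: "card Q < r" unfolding r_def by (rule psubset_card_mono[OF fin(1)])
  define P a where "P = n - r - s" and "a = n - r - (k - card Q)"
  have "real (card M) \<le> card N" using M(1) card_mono[OF fin(2)] by simp
  also note small
  also have "(k / (2 * real n)) ^ (s + r) * (n - 1 choose k) \<le> (P choose (k - card Q - s))"
    unfolding P_def by (rule binomial_reference_ge[OF q s n])
  also have "P choose (k - card Q - s) = P choose a"
    using q s n by (subst binomial_symmetric) (auto simp: a_def P_def)
  finally have "card M * (P choose (k - 1)) \<le> card (kneser_neighbours ?Y (k - 1) N) * (P choose a)"
    using N(1) nsets_mono[of "X - {x}" X k] q s n unfolding M_def a_def n_def r_def
    by (intro card_kneser_neighbours_ge X R(1)) auto
  then have shadow: "real (card M) * (P choose (k - 1))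
      \<le> card (kneser_neighbours ?Y (k - 1) N) * real (P choose a)"
    by (simp only: of_nat_mult[symmetric] of_nat_le_iff)
  have "r * card N \<le> r * (2 ^ r * card M)" using M(2) by (rule mult_le_mono2)
  then have "real (r * card N) * (P choose a) \<le> real (r * (2 ^ r * card M)) * (P choose a)"
    by (intro mult_right_mono of_nat_mono) auto
  also have "\<dots> = card M * (real (r * 2 ^ r) * (P choose a))" by simp
  also have "\<dots> < card M * real (P choose (k - 1))"
    using binomial_expansion_gt[OF q s n growth] \<open>card M > 0\<close>
    by (intro mult_strict_left_mono) (auto simp: a_def P_def)
  also note shadow
  finally have "real (r * card N) < card (kneser_neighbours ?Y (k - 1) N)"
    by (rule mult_right_less_imp_less) simp
  then show ?thesis by (simp only: of_nat_less_iff)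
qed

text \<open>
  Setting \<open>s\<close> further points aside, Kruskal-Katona gains the factor \<open>(n/2k)^s\<close> on families of density
  at most \<open>(k/2n)^(s + r)\<close>.
\<close>
definition expanding_depth :: "nat \<Rightarrow> nat \<Rightarrow> nat \<Rightarrow> nat \<Rightarrow> bool" where
  "expanding_depth r n k s \<longleftrightarrow> 2 * (s + r) \<le> k \<and>
     error_bound r n k \<le> (k / (2 * real n)) ^ (s + r) \<and>
     real (r * 2 ^ r) < (n / (2 * real k)) ^ s * (k / real n)"

theorem (in intersecting_families) extremal_imp_hitting:
  defines "n \<equiv> card X"
  assumes r: "1 \<le> r" and n: "2 * k + 2 * r \<le> n"
    and large: "(n choose k) - (n - r choose k) \<le> card covered"
    and err: "error_bound r n k < 1"
    and depth: "error_bound r n k * (n - 1 choose k) < 1 \<or> (\<exists>s. expanding_depth r n k s)"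
  shows "\<exists>R\<in>[X]\<^bsup>r\<^esup>. covered = hitting X k R"
proof -
  have "\<exists>x\<in>X. card (avoiding x (G i)) \<le> error_bound r n k * (n - 1 choose k)" if "i \<in> I" for i
    using exists_center_error_bound[OF _ that] r n large err unfolding n_def by auto
  then obtain x where x: "\<And>i. i \<in> I \<Longrightarrow> x i \<in> X"
    "\<And>i. i \<in> I \<Longrightarrow> card (avoiding (x i) (G i)) \<le> error_bound r n k * (n - 1 choose k)"
    by metis
  have "card (x ` I) \<le> r" using card_image_le[OF finite_index, of x] card_index by simp
  then obtain R where R: "x ` I \<subseteq> R" "R \<subseteq> X" "card R = r"
    using exists_subset_between[of "x ` I" r X] x(1) r_le finite_ground by (metis image_subsetI)
  have "covered = hitting X k R"
  proof (rule covered_eq_hitting[where x = x])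
    show "card (hitting X k R) \<le> card covered"
      using large card_hitting[OF finite_ground R(2), of k] R(3) by (simp add: n_def)
    fix i assume i: "i \<in> I" and "avoiding (x i) (G i) \<noteq> {}"
    let ?N = "avoiding (x i) (G i)"
    have "finite ?N" using finite_family[OF i] by (simp add: avoiding_def)
    then have "1 \<le> card ?N" using \<open>?N \<noteq> {}\<close> by (simp add: Suc_le_eq card_gt_0_iff)
    then have "1 \<le> real (card ?N)" by simp
    then obtain s where s: "expanding_depth r n k s" using x(2)[OF i] depth by fastforce
    have N: "?N \<subseteq> [X - {x i}]\<^bsup>k\<^esup>" using uniform[OF i] by (auto simp: avoiding_def nsets_def)
    have "card ?N \<le> error_bound r n k * (n - 1 choose k)" by (rule x(2)[OF i])
    also have "\<dots> \<le> (k / (2 * real n)) ^ (s + r) * (n - 1 choose k)"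
      using s by (intro mult_right_mono) (auto simp: expanding_depth_def)
    finally show "card R * card ?N < card (kneser_neighbours (X - R) (k - 1) ?N)"
      using s n R i \<open>?N \<noteq> {}\<close> N
      by (intro card_kneser_neighbours_gt finite_ground) (auto simp: expanding_depth_def n_def)
  qed (use R card_index in auto)
  moreover have "R \<in> [X]\<^bsup>r\<^esup>" using R finite_ground by (auto simp: nsets_def intro: finite_subset)
  ultimately show ?thesis by blast
qed

section \<open>Choice of parameters\<close>

lemma cube_root_powers:
  fixes x :: real
  assumes "0 < x"
  shows "(x powr (1/3)) ^ 3 = x" "x powr (2/3) = (x powr (1/3))\<^sup>2"
  using assms by (simp_all add: powr_powr flip: powr_numeral)

lemma gap_squared_ge_dense:
  fixes M t w z :: real
  assumes "1 \<le> M" "0 \<le> w" "0 \<le> z" "w ^ 3 \<le> 4 * z ^ 3" and gap: "(32 * M)\<^sup>2 * z\<^sup>2 \<le> t"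
  shows "8 * w ^ 3 * (M * w) \<le> t\<^sup>2"
proof -
  have "4 * z ^ 3 \<le> (2 * z) ^ 3" using assms(3) by (simp add: power_mult_distrib)
  with assms(4) have "w ^ 3 \<le> (2 * z) ^ 3" by (rule order_trans)
  then have "w \<le> 2 * z"
    using assms(3) by (intro power_le_imp_le_base[of w 2 "2 * z"]) (auto simp: numeral_3_eq_3)
  then have "8 * w ^ 3 * (M * w) \<le> 8 * (4 * z ^ 3) * (M * (2 * z))"
    using assms by (intro mult_mono) auto
  also have "\<dots> = 2 * (32 * M) * z ^ 4" by (simp add: eval_nat_numeral)
  also have "\<dots> \<le> (32 * M) ^ 4 * z ^ 4"
  proof (rule mult_right_mono)
    have "2 * (32 * M) \<le> (32 * M) * (32 * M)" using assms(1) by (intro mult_right_mono) auto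
    also have "\<dots> = (32 * M) ^ 2" by (simp only: power2_eq_square)
    also have "\<dots> \<le> (32 * M) ^ 4" using assms(1) by (intro power_increasing) auto
    finally show "2 * (32 * M) \<le> (32 * M) ^ 4" .
  qed simp
  also have "\<dots> = ((32 * M)\<^sup>2 * z\<^sup>2)\<^sup>2" by (simp add: power_mult_distrib)
  also have "\<dots> \<le> t\<^sup>2" using gap by (intro power_mono) auto
  finally show ?thesis .
qed

lemma gap_squared_ge_sparse:
  fixes M t w :: real
  assumes "1 \<le> M" "0 \<le> w" "(32 * M)\<^sup>2 \<le> w ^ 3" "w ^ 3 \<le> 2 * t"
  shows "8 * w ^ 3 * (M * w) \<le> t\<^sup>2"
proof -
  have "(32 * M) ^ 3 \<le> ((32 * M)\<^sup>2)\<^sup>2"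
    unfolding power_mult[symmetric] using assms(1) by (intro power_increasing) auto
  also have "\<dots> \<le> (w ^ 3)\<^sup>2" using assms(3) by (intro power_mono) auto
  also have "\<dots> = (w\<^sup>2) ^ 3" by (simp flip: power_mult)
  finally have "32 * M \<le> w\<^sup>2"
    by (intro power_le_imp_le_base[of "32 * M" 2 "w\<^sup>2"]) (auto simp: numeral_3_eq_3)
  then have "w ^ 3 * w * (32 * M) \<le> w ^ 3 * w * w\<^sup>2" using assms(2) by (intro mult_left_mono) auto
  also have "\<dots> = (w ^ 3)\<^sup>2" by (simp add: eval_nat_numeral)
  also have "\<dots> \<le> (2 * t)\<^sup>2" using assms(2,4) by (intro power_mono) auto
  finally show ?thesis by (simp add: power_mult_distrib mult_ac)
qed

lemma gap_squared_ge:
  fixes n k :: nat and M :: real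
  assumes M: "1 \<le> M" and k: "1 \<le> k" and gap: "2 * real k + (32 * M)\<^sup>2 * real k powr (2/3) \<le> n"
  shows "8 * n * (M * real n powr (1/3)) \<le> (real n - 2 * real k)\<^sup>2"
proof -
  define t z w where "t = real n - 2 * real k" and "z = real k powr (1/3)" and "w = real n powr (1/3)"
  have z: "1 \<le> z" "z ^ 3 = k"
    using k cube_root_powers[of k] by (auto simp: z_def intro!: ge_one_powr_ge_zero)
  have t_ge: "(32 * M)\<^sup>2 * z\<^sup>2 \<le> t"
    using gap k cube_root_powers(2)[of k] by (simp add: t_def z_def)
  have "(32 * M)\<^sup>2 \<le> (32 * M)\<^sup>2 * z\<^sup>2" using mult_left_mono[of 1 "z\<^sup>2" "(32 * M)\<^sup>2"] z(1) by simp
  then have n_ge: "(32 * M)\<^sup>2 \<le> n" using t_ge by (simp add: t_def)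
  moreover have "0 < (32 * M)\<^sup>2" using M by simp
  ultimately have "0 < real n" by (rule order.strict_trans2[rotated])
  then have w: "0 \<le> w" "w ^ 3 = n" using cube_root_powers(1)[of n] by (auto simp: w_def)
  have "8 * w ^ 3 * (M * w) \<le> t\<^sup>2"
  proof (cases "n \<le> 4 * k")
    case True
    then show ?thesis using z by (intro gap_squared_ge_dense[OF M w(1) _ _ t_ge]) (auto simp: w(2))
  next
    case False
    then show ?thesis using n_ge by (intro gap_squared_ge_sparse[OF M w(1)]) (auto simp: w(2) t_def)
  qed
  then show ?thesis by (simp add: w(2)) (simp add: t_def w_def)
qed

lemma error_bound_le_exp:
  fixes m :: real
  assumes "1 \<le> n"
    and gap: "8 * real n * ((400 * 2 ^ r + 6 + m) * real n powr (1/3)) \<le> (real n - 2 * real k)\<^sup>2"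
  shows "error_bound r n k \<le> exp (- (m * real n powr (1/3)))"
proof -
  define w where "w = real n powr (1/3)"
  define B where "B = (400 * 2 ^ r :: real)"
  have w: "1 \<le> w" "w ^ 3 = n"
    using assms(1) cube_root_powers[of n] by (auto simp: w_def intro!: ge_one_powr_ge_zero)
  have "B \<le> exp B" using exp_ge_add_one_self[of B] by linarith
  also have "\<dots> \<le> exp (B * w)" using mult_left_mono[OF w(1), of B] by (simp add: B_def)
  finally have B_le: "B \<le> exp (B * w)" .
  have "w \<le> exp w" using exp_ge_add_one_self[of w] by linarith
  then have "w ^ 6 \<le> exp w ^ 6" using w(1) by (intro power_mono) auto
  then have n_le: "real n ^ 2 \<le> exp (6 * w)"
    by (simp add: exp_of_nat_mult[symmetric] flip: w(2) power_mult)
  have "error_bound r n k \<le> B * real n ^ 2 * exp (- ((B + 6 + m) * w))"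
    unfolding error_bound_def B_def using gap assms(1)
    by (intro mult_left_mono) (auto simp: w_def field_simps)
  also have "\<dots> \<le> exp (B * w) * exp (6 * w) * exp (- ((B + 6 + m) * w))"
    using B_le n_le by (intro mult_right_mono mult_mono) auto
  also have "\<dots> = exp (- (m * w))" by (simp add: algebra_simps flip: exp_add)
  finally show ?thesis by (simp add: w_def)
qed

lemma choose_le_exp: "(N choose k) \<le> exp (3 * real k * real N powr (1/3))"
proof (cases "N = 0 \<or> N < k")
  case True
  then have "N choose k \<le> 1" by (cases "k = 0") (auto simp: binomial_eq_0)
  moreover have "1 \<le> exp (3 * real k * real N powr (1/3))" by simp
  ultimately show ?thesis by linarith
next
  case False
  define w where "w = real N powr (1/3)"
  have "w \<le> exp w" using exp_ge_add_one_self[of w] by linarith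
  then have "real N \<le> exp w ^ 3"
    using cube_root_powers(1)[of N] False power_mono[of w "exp w" 3] by (simp add: w_def)
  then have "real N ^ k \<le> exp (3 * w) ^ k" by (intro power_mono) (auto simp: exp_of_nat_mult[symmetric])
  moreover have "real (N choose k) \<le> real N ^ k"
    using False binomial_le_pow[of k N] by (metis not_less of_nat_le_iff of_nat_power)
  ultimately have "real (N choose k) \<le> exp (3 * w) ^ k" by linarith
  then show ?thesis by (simp add: w_def exp_of_nat_mult[symmetric] mult_ac)
qed

lemma ratio_power_ge_exp:
  fixes n k j :: nat
  assumes "1 \<le> k" "1 \<le> n"
  shows "exp (- (6 * real j * real n powr (1/3) / real k powr (1/3))) \<le> (k / (2 * real n)) ^ j"
proof -
  define u where "u = real n powr (1/3) / real k powr (1/3)"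
  have u: "u ^ 3 = n / k" "0 \<le> u"
    using assms cube_root_powers(1)[of n] cube_root_powers(1)[of k] by (auto simp: u_def power_divide)
  have "2 * real n / real k \<le> 8 * (n / k)" by (simp add: divide_right_mono)
  also have "\<dots> = (2 * u) ^ 3" by (simp add: u power_mult_distrib)
  also have "\<dots> \<le> exp (2 * u) ^ 3"
    using u(2) exp_ge_add_one_self[of "2 * u"] by (intro power_mono) linarith+
  also have "\<dots> = exp (6 * u)" by (simp add: exp_of_nat_mult[symmetric])
  finally have "exp (- (6 * u)) \<le> k / (2 * real n)"
    using assms by (simp add: exp_minus field_simps)
  then have "exp (- (6 * u)) ^ j \<le> (k / (2 * real n)) ^ j" by (intro power_mono) auto
  then show ?thesis by (simp add: u_def exp_of_nat_mult[symmetric] mult_ac)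
qed

lemma mult_two_power_less: "real (r * 2 ^ r) < 2 ^ (2 * r)"
proof -
  have "r * 2 ^ r < 2 ^ r * (2 ^ r :: nat)" by (intro mult_strict_right_mono) auto
  then have "real (r * 2 ^ r) < real (2 ^ r * 2 ^ r)" by (simp only: of_nat_less_iff)
  then show ?thesis by (simp add: mult_2 power_add)
qed

lemma exp_relative_gap_le:
  fixes n k :: real
  assumes "0 < k" "0 < n"
  shows "exp ((n - 2 * k) / n) \<le> n / (2 * k)"
proof -
  have "2 * k / n = 1 + - ((n - 2 * k) / n)" using assms by (simp add: field_simps)
  also have "\<dots> \<le> exp (- ((n - 2 * k) / n))" by (rule exp_ge_add_one_self)
  finally show ?thesis using assms by (simp add: exp_minus field_simps)
qed

lemma exists_growth_depth:
  fixes n k r :: nat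
  assumes "1 \<le> k" and gap: "2 * real k + (4 * r + 2) * real k powr (2/3) \<le> n"
  shows "\<exists>s. real s \<le> 2 * r + 3 + real k powr (1/3) \<and>
    real (r * 2 ^ r) < (n / (2 * real k)) ^ s * (k / real n)"
proof -
  define t z where "t = real n - 2 * real k" and "z = real k powr (1/3)"
  define d where "d = nat \<lceil>(2 * r + 1) * (n / t)\<rceil>"
  have z: "0 < z" "z ^ 3 = k" using assms(1) cube_root_powers[of k] by (auto simp: z_def)
  have t: "(4 * r + 2) * z\<^sup>2 \<le> t"
    using gap assms(1) cube_root_powers(2)[of k] by (simp add: t_def z_def)
  have "0 < (4 * r + 2) * z\<^sup>2" using z by (simp add: add_pos_nonneg)
  then have "0 < t" using t by linarith
  then have n: "0 < real n" "0 < real k" using assms(1) by (auto simp: t_def)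
  have "2 * real k / t \<le> 2 * z ^ 3 / ((4 * r + 2) * z\<^sup>2)"
    unfolding z(2) using t \<open>0 < t\<close> \<open>0 < (4 * r + 2) * z\<^sup>2\<close> by (intro divide_left_mono mult_pos_pos) auto
  also have "\<dots> = (2 * z\<^sup>2 * z) / (2 * z\<^sup>2 * (2 * r + 1))" by (simp add: algebra_simps eval_nat_numeral)
  also have "\<dots> = z / (2 * r + 1)" using z(1) by simp
  finally have "(2 * r + 1) * (1 + 2 * real k / t) \<le> 2 * r + 1 + z" by (simp add: field_simps)
  moreover have "n / t = 1 + 2 * real k / t" using \<open>0 < t\<close> by (simp add: t_def field_simps)
  ultimately have ratio: "(2 * r + 1) * (n / t) \<le> 2 * r + 1 + z" by (simp only:)
  have d: "(2 * r + 1) * (n / t) \<le> d" "d \<le> 2 * r + 2 + z"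
  proof -
    have "0 \<le> (2 * r + 1) * (n / t)" using \<open>0 < t\<close> by simp
    then show "(2 * r + 1) * (n / t) \<le> d" "d \<le> 2 * r + 2 + z" using ratio unfolding d_def by linarith+
  qed
  have "real (r * 2 ^ r) < 2 ^ (2 * r)" by (rule mult_two_power_less)
  also have "\<dots> = 2 ^ (2 * r + 1) / 2" by simp
  also have "\<dots> \<le> exp 1 ^ (2 * r + 1) / 2"
    using exp_ge_add_one_self[of 1] by (intro divide_right_mono power_mono) auto
  also have "\<dots> = exp (2 * r + 1) / 2" by (simp add: exp_of_nat_mult[symmetric] mult_exp_exp)
  also have "\<dots> \<le> exp (t / n) ^ d / 2"
    using d(1) \<open>0 < t\<close> n by (simp add: exp_of_nat_mult[symmetric] field_simps)
  also have "\<dots> \<le> (n / (2 * real k)) ^ d / 2"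
    unfolding t_def using n by (intro divide_right_mono power_mono exp_relative_gap_le) auto
  also have "\<dots> = (n / (2 * real k)) ^ Suc d * (k / real n)" using n by simp
  finally show ?thesis using d(2) by (intro exI[of _ "Suc d"]) (simp add: z_def)
qed

text \<open>
  \<open>400 * 2 ^ r + 6\<close> absorbs the prefactor of \<open>error_bound\<close>; the remaining \<open>54 * r + 67\<close> exceeds
  both \<open>3 * (18 * r + 22)\<close> and \<open>6 * (3 * r + 4)\<close>, as needed for \<open>k \<le> 18 * r + 22\<close> and for larger \<open>k\<close>.
\<close>
definition gap_scale :: "nat \<Rightarrow> real" where
  "gap_scale r = 400 * 2 ^ r + 54 * r + 73"

definition gap_constant :: "nat \<Rightarrow> real" where
  "gap_constant r = (32 * gap_scale r)\<^sup>2"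

lemma gap_scale_ge: "4 * real r + 2 \<le> gap_scale r" "1 \<le> gap_scale r"
  by (simp_all add: gap_scale_def add_increasing)

lemma gap_constant_ge: "4 * real r + 2 \<le> gap_constant r"
proof -
  have "1 * gap_scale r \<le> (32 * gap_scale r) * (32 * gap_scale r)"
    using gap_scale_ge(2)[of r] by (intro mult_mono) auto
  then show ?thesis
    using gap_scale_ge(1)[of r] unfolding gap_constant_def power2_eq_square by linarith
qed

context
  fixes n k r :: nat
  assumes k: "1 \<le> k" and gap: "2 * real k + gap_constant r * real k powr (2/3) \<le> n"
begin

lemma two_mult_add_le_of_gap: "2 * k + 2 * r \<le> n"
proof -
  have "1 \<le> real k powr (2/3)" using k by (intro ge_one_powr_ge_zero) auto
  then have "gap_constant r \<le> gap_constant r * real k powr (2/3)"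
    using mult_left_mono[of 1 _ "gap_constant r"] by (simp add: gap_constant_def)
  then show ?thesis using gap gap_constant_ge[of r] by linarith
qed

lemma error_bound_le_exp_of_gap: "error_bound r n k \<le> exp (- ((54 * r + 67) * real n powr (1/3)))"
proof (rule error_bound_le_exp)
  show "1 \<le> n" using two_mult_add_le_of_gap k by simp
  have "400 * 2 ^ r + 6 + real (54 * r + 67) = gap_scale r" by (simp add: gap_scale_def)
  then show "8 * real n * ((400 * 2 ^ r + 6 + real (54 * r + 67)) * real n powr (1/3))
      \<le> (real n - 2 * real k)\<^sup>2"
    using gap_squared_ge[OF gap_scale_ge(2) k gap[unfolded gap_constant_def]] by simp
qed

lemma error_bound_less_1: "error_bound r n k < 1"
proof -
  have "0 < real n powr (1/3)" using two_mult_add_le_of_gap k by simp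
  then have "exp (- ((54 * r + 67) * real n powr (1/3))) < 1" by (simp add: add_nonneg_pos)
  with error_bound_le_exp_of_gap show ?thesis by (rule le_less_trans)
qed

lemma error_bound_choose_less_1:
  assumes "k \<le> 18 * r + 22"
  shows "error_bound r n k * (n - 1 choose k) < 1"
proof -
  define w where "w = real n powr (1/3)"
  have "0 < w" using two_mult_add_le_of_gap k by (simp add: w_def)
  have "real (n - 1 choose k) \<le> exp (3 * real k * real (n - 1) powr (1/3))"
    by (rule choose_le_exp)
  also have "\<dots> \<le> exp (3 * real k * w)"
    unfolding w_def by (simp add: mult_left_mono powr_mono2)
  finally have "error_bound r n k * (n - 1 choose k)
      \<le> exp (- ((54 * r + 67) * w)) * exp (3 * real k * w)"
    using error_bound_le_exp_of_gap unfolding w_def by (intro mult_mono) auto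
  also have "\<dots> = exp ((3 * real k - (54 * r + 67)) * w)"
    by (simp add: algebra_simps flip: exp_add)
  also have "\<dots> < 1" using assms \<open>0 < w\<close> by (simp add: mult_neg_pos)
  finally show ?thesis .
qed

lemma exists_expanding_depth:
  assumes "18 * r + 22 < k"
  shows "\<exists>s. expanding_depth r n k s"
proof -
  define z w where "z = real k powr (1/3)" and "w = real n powr (1/3)"
  have n: "1 \<le> n" using two_mult_add_le_of_gap k by simp
  have "0 \<le> w" by (simp add: w_def)
  have z: "1 \<le> z" "z ^ 3 = k"
    using k cube_root_powers[of k] by (auto simp: z_def intro!: ge_one_powr_ge_zero)
  have "2 * real k + (4 * r + 2) * real k powr (2/3) \<le> n"
    using gap mult_right_mono[OF gap_constant_ge[of r], of "real k powr (2/3)"]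
    by (simp add: add.commute)
  then obtain s where s: "s \<le> 2 * r + 3 + z"
    and growth: "real (r * 2 ^ r) < (n / (2 * real k)) ^ s * (k / real n)"
    using exists_growth_depth[OF k] unfolding z_def by blast
  have "0 \<le> (z - 1)\<^sup>2 * (z + 2)" using z(1) by simp
  also have "\<dots> = z ^ 3 + 2 - 3 * z" by (simp add: algebra_simps eval_nat_numeral)
  finally have "3 * z \<le> real k + 2" by (simp add: z(2))
  moreover have "18 * real r + 22 < real k" using assms by linarith
  ultimately have "2 * real (s + r) \<le> real k" using s by simp
  then have s_le: "2 * (s + r) \<le> k" by linarith
  have "s + r \<le> (3 * r + 4) * z"
    using s z(1) mult_left_mono[OF z(1), of "3 * real r + 3"] by (simp add: algebra_simps)
  then have "6 * real (s + r) * w \<le> 6 * ((3 * r + 4) * z) * w"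
    using \<open>0 \<le> w\<close> by (intro mult_right_mono) auto
  then have "6 * real (s + r) * w / z \<le> 6 * (3 * r + 4) * w"
    using z(1) by (simp add: divide_le_eq mult_ac)
  also have "\<dots> \<le> (54 * r + 67) * w" using \<open>0 \<le> w\<close> by (intro mult_right_mono) auto
  finally have "exp (- ((54 * r + 67) * w)) \<le> exp (- (6 * real (s + r) * w / z))" by simp
  with error_bound_le_exp_of_gap have "error_bound r n k \<le> exp (- (6 * real (s + r) * w / z))"
    unfolding w_def by (rule order_trans)
  also have "\<dots> \<le> (k / (2 * real n)) ^ (s + r)"
    unfolding w_def z_def by (rule ratio_power_ge_exp[OF k n])
  finally show ?thesis using s_le growth unfolding expanding_depth_def by blast
qed

end

theorem union_of_intersecting_extremal:
  assumes r: "1 \<le> r" and k: "1 \<le> k" and gap: "2 * real k + gap_constant r * real k powr (2/3) \<le> n"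
    and union: "union_of_intersecting r n k F"
    and large: "(n choose k) - (n - r choose k) \<le> card F"
  shows "\<exists>R\<in>[{1..n}]\<^bsup>r\<^esup>. F = hitting {1..n} k R"
proof -
  obtain m G where G: "m \<le> r" "\<And>i. i \<in> {1..m} \<Longrightarrow> G i \<subseteq> [{1..n}]\<^bsup>k\<^esup> \<and> intersecting (G i)"
    and F: "F = (\<Union>i\<in>{1..m}. G i)"
    using union unfolding union_of_intersecting_def by blast
  interpret intersecting_families "{1..n}" k r "{1..m}" G
    using G k two_mult_add_le_of_gap[OF k gap] by unfold_locales auto
  have "error_bound r n k * (n - 1 choose k) < 1 \<or> (\<exists>s. expanding_depth r n k s)"
    using error_bound_choose_less_1[OF k gap] exists_expanding_depth[OF k gap] by (meson not_le)
  then show ?thesis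
    using extremal_imp_hitting[OF r] large two_mult_add_le_of_gap[OF k gap] error_bound_less_1[OF k gap]
    by (simp add: F)
qed

theorem theorem1p3:
  fixes r :: nat
  assumes "r \<ge> 2"
  shows "\<exists>C::real. C > 0 \<and>
    (\<forall>(n::nat) (k::nat) (F::nat set set).
       n > 0 \<longrightarrow> k > 0 \<longrightarrow>
       real n \<ge> 2 * real k + C * real k powr (2/3) \<longrightarrow>
       F \<subseteq> [{1..n}]\<^bsup>k\<^esup> \<longrightarrow>
       union_of_intersecting r n k F \<longrightarrow>
         card F \<le> (n choose k) - ((n - r) choose k) \<and>
         (card F = (n choose k) - ((n - r) choose k) \<longrightarrow>
            (\<exists>R\<in>[{1..n}]\<^bsup>r\<^esup>. F = {S\<in>[{1..n}]\<^bsup>k\<^esup>. S \<inter> R \<noteq> {}})))"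
proof (intro exI[of _ "gap_constant r"] conjI allI impI)
  show "gap_constant r > 0" using gap_constant_ge[of r] by linarith
  fix n k :: nat and F :: "nat set set"
  assume "k > 0" "2 * real k + gap_constant r * real k powr (2/3) \<le> n" "union_of_intersecting r n k F"
  then have extremal: "\<exists>R\<in>[{1..n}]\<^bsup>r\<^esup>. F = hitting {1..n} k R"
    if "(n choose k) - (n - r choose k) \<le> card F"
    using union_of_intersecting_extremal[of r k n F] assms that by simp
  show "\<exists>R\<in>[{1..n}]\<^bsup>r\<^esup>. F = {S\<in>[{1..n}]\<^bsup>k\<^esup>. S \<inter> R \<noteq> {}}"
    if "card F = (n choose k) - (n - r choose k)"
    using extremal that by (simp add: hitting_def)
  show "card F \<le> (n choose k) - (n - r choose k)"
  proof (rule ccontr)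
    assume "\<not> ?thesis"
    with extremal obtain R where "R \<in> [{1..n}]\<^bsup>r\<^esup>" "F = hitting {1..n} k R" by auto
    with \<open>\<not> ?thesis\<close> show False using card_hitting[of "{1..n}" R k] by (simp add: nsets_def)
  qed
qed

end
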